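(* Let $n\ge 1$. The set $$\mathcal{D}_n=\big\{\Delta_{C(\alpha)} : \alpha\in\{0,1\}^n \text{ a ballot sequence}\big\}$$ is a basis of $EQH_n$, and (its image in the quotient is) a basis of $EQC_n=R_n/I_n$.
   Context: Let $R_n=\mathbb{Q}[\theta_1,\dots,\theta_n]$ be the polynomial ring in anticommuting variables over $\mathbb{Q}$ (exterior algebra): $\theta_i\theta_j=-\theta_j\theta_i$ for $i\ne j$, $\theta_i^2=0$. For $A=\{a_1<\cdots<a_r\}\subseteq[n]$ put $\theta_A=\theta_{a_1}\cdots\theta_{a_r}$, and $F_{1^r}=\sum_{A\subseteq[n],|A|=r}\theta_A$. Let $I_n$ be the ideal of $R_n$ generated by $F_{1^r}$, $1\le r\le n$, and $EQC_n=R_n/I_n$. Operators $\partial_{\theta_i}$ on $R_n$: $\partial_{\theta_i}(\theta_A)=(-1)^{\#\{j\in A: j<i\}}\theta_{A\setminus\{i\}}$ if $i\in A$, and $0$ otherwise. The inner product on $R_n$ is $\langle p,q\rangle=\overline{p(\partial_{\theta_1},\dots,\partial_{\theta_n})}\,q(\theta_1,\dots,\theta_n)|_{\theta_1=\cdots=\theta_n=0}$, where the bar reverses the order of the factors in every monomial; the monomials $\theta_A$ are an orthonormal basis for it. Define $EQH_n=\{q\in R_n:\langle p,q\rangle=0\text{ for all }p\in I_n\}$. A ballot sequence is $\alpha=(a_1,\dots,a_n)\in\{0,1\}^n$ with $\sum_{i=1}^r a_i\le r/2$ for all $1\le r\le n$. Given a ballot sequence $\alpha$, replace each $0$ by an open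 parenthesis and each $1$ by a closing parenthesis and perform the usual maximal matching of parentheses (every closing parenthesis gets matched; some open ones may remain unmatched). Let $C(\alpha)=((i_1,j_1),\dots,(i_k,j_k))$ be the list of matched pairs of positions ($i_r<j_r$, $i_r$ the open and $j_r$ the closing parenthesis), ordered so that $j_1<j_2<\cdots<j_k$. E.g. $\alpha=0010001101$ gives $C(\alpha)=((2,3),(6,7),(5,8),(9,10))$. Define $\Delta_{C(\alpha)}=(\theta_{j_1}-\theta_{i_1})(\theta_{j_2}-\theta_{i_2})\cdots(\theta_{j_k}-\theta_{i_k})$, with $\Delta_{C(\alpha)}=1$ if $k=0$. *)

theory Defs
  imports "Jordan_Normal_Form.VS_Connect" "HOL-Algebra.QuotRing"
begin

section \<open>The exterior algebra on \<open>n\<close> generators\<close>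

text \<open>An element of the exterior algebra \<open>\<rat>[\<theta>\<^sub>1, \<dots>, \<theta>\<^sub>n]\<close> is represented by its coefficient
  function with respect to the basis of monomials \<open>\<theta>\<^sub>A\<close>, \<open>A \<subseteq> {1..n}\<close>.\<close>

type_synonym ext = "nat set \<Rightarrow> rat"

definition theta :: "nat set \<Rightarrow> ext" where
  "theta A = (\<lambda>B. if B = A then 1 else 0)"

text \<open>For disjoint \<open>A\<close> and \<open>B\<close>, \<open>\<theta>\<^sub>A \<theta>\<^sub>B = wsign A B \<cdot> \<theta>\<^bsub>A \<union> B\<^esub>\<close>: the exponent counts the
  transpositions needed to sort the concatenated word. For non-disjoint \<open>A\<close> and \<open>B\<close> the product
  vanishes, which is why \<open>wedge\<close> only sums over splittings \<open>C = A \<union> (C - A)\<close>.\<close>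

definition wsign :: "nat set \<Rightarrow> nat set \<Rightarrow> rat" where
  "wsign A B = (- 1) ^ card {(a, b). a \<in> A \<and> b \<in> B \<and> b < a}"

definition wedge :: "ext \<Rightarrow> ext \<Rightarrow> ext" where
  "wedge p q = (\<lambda>C. \<Sum>A\<in>Pow C. wsign A (C - A) * p A * q (C - A))"

definition ext_alg :: "nat \<Rightarrow> (rat, ext) module" where
  "ext_alg n =
    \<lparr>carrier = {p. \<forall>A. p A \<noteq> 0 \<longrightarrow> A \<subseteq> {1..n}},
     mult = wedge, one = theta {}, zero = (\<lambda>_. 0), add = (\<lambda>p q A. p A + q A),
     smult = (\<lambda>c p A. c * p A)\<rparr>"


section \<open>The ideal, the quotient and the orthogonal complement\<close>

definition F1 :: "nat \<Rightarrow> nat \<Rightarrow> ext" where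
  "F1 n r = (\<Oplus>\<^bsub>ext_alg n\<^esub> A\<in>{A. A \<subseteq> {1..n} \<and> card A = r}. theta A)"

definition EQI :: "nat \<Rightarrow> ext set" where
  "EQI n = Idl\<^bsub>ext_alg n\<^esub> {F1 n r | r. 1 \<le> r \<and> r \<le> n}"

definition EQproj :: "nat \<Rightarrow> ext \<Rightarrow> ext set" where
  "EQproj n p = EQI n +>\<^bsub>ext_alg n\<^esub> p"

text \<open>The scalar multiplication on cosets follows the pattern of \<^const>\<open>rcoset_mult\<close>.\<close>

definition EQC :: "nat \<Rightarrow> (rat, ext set) module" where
  "EQC n = ring.extend (ext_alg n Quot EQI n)
     \<lparr>smult = (\<lambda>c X. \<Union>x\<in>X. EQproj n (c \<odot>\<^bsub>ext_alg n\<^esub> x))\<rparr>"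

text \<open>The coefficient of \<open>\<theta>\<^sub>B\<close> in \<open>\<partial>\<^sub>i p\<close> comes from the single monomial \<open>\<theta>\<^bsub>insert i B\<^esub>\<close> of \<open>p\<close>;
  see \<open>dtheta_theta\<close> for the action on monomials.\<close>

definition dtheta :: "nat \<Rightarrow> ext \<Rightarrow> ext" where
  "dtheta i p = (\<lambda>B. if i \<in> B then 0 else (- 1) ^ card {j \<in> B. j < i} * p (insert i B))"

text \<open>For \<open>A = {a\<^sub>1 < \<dots> < a\<^sub>r}\<close>, the bar turns \<open>\<theta>\<^sub>A\<close> into the operator \<open>\<partial>\<^bsub>a_r\<^esub> \<circ> \<dots> \<circ> \<partial>\<^bsub>a_1\<^esub>\<close>,
  whose first factor to act is \<open>\<partial>\<^bsub>a_1\<^esub>\<close>; this is the order in which \<^const>\<open>fold\<close> applies them.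
  Setting all variables to zero reads off the coefficient of \<open>\<theta>\<^bsub>{}\<^esub> = 1\<close>.\<close>

definition ext_inner :: "nat \<Rightarrow> ext \<Rightarrow> ext \<Rightarrow> rat" where
  "ext_inner n p q = (\<Sum>A\<in>Pow {1..n}. p A * fold dtheta (sorted_list_of_set A) q {})"

definition EQH :: "nat \<Rightarrow> (rat, ext) module" where
  "EQH n = (ext_alg n)\<lparr>carrier :=
     {q \<in> carrier (ext_alg n). \<forall>p\<in>EQI n. ext_inner n p q = 0}\<rparr>"


section \<open>Ballot sequences and the elements \<open>\<Delta>\<close>\<close>

text \<open>The entry \<open>a\<^sub>i\<close> of a sequence is the list element at index \<open>i - 1\<close>.\<close>

definition ballot :: "nat list \<Rightarrow> bool" where
  "ballot \<alpha> \<longleftrightarrow> set \<alpha> \<subseteq> {0, 1} \<and>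
     (\<forall>r\<in>{1..length \<alpha>}. rat_of_nat (sum_list (take r \<alpha>)) \<le> rat_of_nat r / 2)"

text \<open>Parenthesis matching with a stack: \<open>j\<close> is the position of the next letter and \<open>st\<close> holds the
  positions of the currently unmatched open parentheses, innermost first. Pairs are emitted when
  their closing parenthesis is read, hence in increasing order of the closing position.\<close>

fun matching :: "nat \<Rightarrow> nat list \<Rightarrow> nat list \<Rightarrow> (nat \<times> nat) list" where
  "matching j st [] = []"
| "matching j st (a # \<alpha>) =
     (if a = 0 then matching (Suc j) (j # st) \<alpha>
      else (case st of [] \<Rightarrow> matching (Suc j) [] \<alpha>
            | i # st' \<Rightarrow> (i, j) # matching (Suc j) st' \<alpha>))"

definition match_pairs :: "nat list \<Rightarrow> (nat \<times> nat) list" where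
  "match_pairs \<alpha> = matching 1 [] \<alpha>"

lemma match_pairs_example:
  "match_pairs [0,0,1,0,0,0,1,1,0,1] = [(2,3), (6,7), (5,8), (9,10)]"
  by (simp add: match_pairs_def)

definition Delta :: "nat \<Rightarrow> (nat \<times> nat) list \<Rightarrow> ext" where
  "Delta n C = foldr (\<lambda>(i, j) x. (theta {j} \<ominus>\<^bsub>ext_alg n\<^esub> theta {i}) \<otimes>\<^bsub>ext_alg n\<^esub> x)
     C \<one>\<^bsub>ext_alg n\<^esub>"

definition Dset :: "nat \<Rightarrow> ext set" where
  "Dset n = {Delta n (match_pairs \<alpha>) | \<alpha>. length \<alpha> = n \<and> ballot \<alpha>}"


section \<open>Basic properties\<close>

lemma theta_prod:
  assumes "finite A" "\<And>j. j \<in> A \<Longrightarrow> i < j"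
  shows "theta (insert i A) = wedge (theta {i}) (theta A)"
proof
  fix C
  have [simp]: "i \<notin> A" using assms(2) by blast
  show "theta (insert i A) C = wedge (theta {i}) (theta A) C"
  proof (cases "finite C")
    case True
    have s: "wsign {i} A = 1"
    proof -
      have "{(a, b). a \<in> {i} \<and> b \<in> A \<and> b < a} = {}" using assms(2) by force
      then show ?thesis unfolding wsign_def by (metis card.empty power_0)
    qed
    have "wedge (theta {i}) (theta A) C =
       (\<Sum>B\<in>Pow C. if B = {i} then wsign {i} (C - {i}) * theta A (C - {i}) else 0)"
      unfolding wedge_def by (rule sum.cong) (auto simp: theta_def)
    also have "\<dots> = (if {i} \<in> Pow C then wsign {i} (C - {i}) * theta A (C - {i}) else 0)"
      using True by (simp add: sum.delta)
    also have "\<dots> = theta (insert i A) C"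
    proof (cases "C = insert i A")
      case True
      then have "C - {i} = A" by simp
      then show ?thesis using s True by (simp add: theta_def)
    next
      case False
      then have "i \<in> C \<Longrightarrow> C - {i} \<noteq> A" by blast
      then show ?thesis using False by (simp add: theta_def)
    qed
    finally show ?thesis by simp
  next
    case False
    then have "C \<noteq> insert i A" "infinite (Pow C)" using assms(1) by auto
    then show ?thesis by (simp add: wedge_def theta_def)
  qed
qed

lemma theta_square: "wedge (theta {i}) (theta {i}) = (\<lambda>_. 0)"
proof
  fix C
  have "theta {i} A * theta {i} (C - A) = 0" for A by (auto simp: theta_def)
  then have "wsign A (C - A) * theta {i} A * theta {i} (C - A) = 0" for A
    by (metis mult.assoc mult_zero_right)
  then show "wedge (theta {i}) (theta {i}) C = 0"
    by (simp add: wedge_def)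
qed

lemma theta_anticomm:
  assumes "i < j"
  shows "wedge (theta {j}) (theta {i}) = (\<lambda>A. - wedge (theta {i}) (theta {j}) A)"
proof
  fix C
  have 1: "wedge (theta {i}) (theta {j}) = theta {i, j}"
    using theta_prod[of "{j}" i] assms by simp
  show "wedge (theta {j}) (theta {i}) C = - wedge (theta {i}) (theta {j}) C"
  proof (cases "finite C")
    case True
    have s: "wsign {j} {i} = - 1"
    proof -
      have "{(a, b). a \<in> {j} \<and> b \<in> {i} \<and> b < a} = {(j, i)}" using assms by force
      then show ?thesis unfolding wsign_def by simp
    qed
    have "wedge (theta {j}) (theta {i}) C =
       (\<Sum>B\<in>Pow C. if B = {j} then wsign {j} (C - {j}) * theta {i} (C - {j}) else 0)"
      unfolding wedge_def by (rule sum.cong) (auto simp: theta_def)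
    also have "\<dots> = (if {j} \<in> Pow C then wsign {j} (C - {j}) * theta {i} (C - {j}) else 0)"
      using True by (simp add: sum.delta)
    also have "\<dots> = - theta {i, j} C"
    proof (cases "C = {i, j}")
      case True
      then have "C - {j} = {i}" using assms by auto
      then show ?thesis using s True by (simp add: theta_def)
    next
      case False
      then have "j \<in> C \<Longrightarrow> C - {j} \<noteq> {i}" by blast
      then show ?thesis using False by (simp add: theta_def)
    qed
    finally show ?thesis by (simp add: 1)
  next
    case False
    then have "C \<noteq> {i, j}" "infinite (Pow C)" by auto
    then show ?thesis unfolding 1 by (simp add: wedge_def theta_def)
  qed
qed

lemma dtheta_theta:
  "dtheta i (theta A) =
     (\<lambda>B. if i \<in> A then (- 1) ^ card {j \<in> A. j < i} * theta (A - {i}) B else 0)"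
proof
  fix B
  have "{j \<in> A. j < i} = {j \<in> A - {i}. j < i}" by auto
  then show "dtheta i (theta A) B =
     (if i \<in> A then (- 1) ^ card {j \<in> A. j < i} * theta (A - {i}) B else 0)"
    by (auto simp: dtheta_def theta_def)
qed

lemma fold_dtheta:
  assumes "sorted_wrt (<) l"
  shows "fold dtheta l q {} = q (set l)"
  using assms
proof (induction l arbitrary: q)
  case (Cons a l)
  then have *: "{j \<in> set l. j < a} = {}" "a \<notin> set l" by auto
  have "fold dtheta (a # l) q {} = dtheta a q (set l)" using Cons by simp
  moreover have "(- 1 :: rat) ^ card {j \<in> set l. j < a} = 1" by (simp only: *(1) card.empty power_0)
  then have "dtheta a q (set l) = q (set (a # l))" using *(2) unfolding dtheta_def by simp
  ultimately show ?case by simp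
qed simp

lemma ext_inner_eq: "ext_inner n p q = (\<Sum>A\<in>Pow {1..n}. p A * q A)"
  unfolding ext_inner_def
proof (rule sum.cong[OF refl])
  fix A :: "nat set" assume "A \<in> Pow {1..n}"
  then have "finite A" using finite_subset by auto
  then show "p A * fold dtheta (sorted_list_of_set A) q {} = p A * q A"
    using fold_dtheta[of "sorted_list_of_set A" q] by simp
qed

lemma theta_orthonormal:
  assumes "A \<subseteq> {1..n}" "B \<subseteq> {1..n}"
  shows "ext_inner n (theta A) (theta B) = (if A = B then 1 else 0)"
proof -
  have "ext_inner n (theta A) (theta B) = (\<Sum>C\<in>Pow {1..n}. if C = A then theta B A else 0)"
    unfolding ext_inner_eq by (rule sum.cong) (auto simp: theta_def)
  also have "\<dots> = theta B A" using assms by (subst sum.delta) auto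
  finally show ?thesis by (simp add: theta_def)
qed

lemma wsign_Un_left:
  assumes "finite A" "finite B" "finite C" "A \<inter> B = {}"
  shows "wsign (A \<union> B) C = wsign A C * wsign B C"
proof -
  have fin: "finite {(a, b). a \<in> X \<and> b \<in> C \<and> b < a}" if "finite X" for X
    by (rule finite_subset[of _ "X \<times> C"]) (use that assms in auto)
  have "{(a, b). a \<in> A \<union> B \<and> b \<in> C \<and> b < a} =
     {(a, b). a \<in> A \<and> b \<in> C \<and> b < a} \<union> {(a, b). a \<in> B \<and> b \<in> C \<and> b < a}" by auto
  moreover have "card \<dots> = card {(a, b). a \<in> A \<and> b \<in> C \<and> b < a} +
      card {(a, b). a \<in> B \<and> b \<in> C \<and> b < a}"
    by (rule card_Un_disjoint) (use fin assms in auto)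
  ultimately show ?thesis unfolding wsign_def by (simp add: power_add)
qed

lemma wsign_Un_right:
  assumes "finite A" "finite B" "finite C" "B \<inter> C = {}"
  shows "wsign A (B \<union> C) = wsign A B * wsign A C"
proof -
  have fin: "finite {(a, b). a \<in> A \<and> b \<in> X \<and> b < a}" if "finite X" for X
    by (rule finite_subset[of _ "A \<times> X"]) (use that assms in auto)
  have "{(a, b). a \<in> A \<and> b \<in> B \<union> C \<and> b < a} =
     {(a, b). a \<in> A \<and> b \<in> B \<and> b < a} \<union> {(a, b). a \<in> A \<and> b \<in> C \<and> b < a}" by auto
  moreover have "card \<dots> = card {(a, b). a \<in> A \<and> b \<in> B \<and> b < a} +
      card {(a, b). a \<in> A \<and> b \<in> C \<and> b < a}"
    by (rule card_Un_disjoint) (use fin assms in auto)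
  ultimately show ?thesis unfolding wsign_def by (simp add: power_add)
qed

lemma wedge_assoc: "wedge (wedge p q) r = wedge p (wedge q r)"
proof
  fix D
  show "wedge (wedge p q) r D = wedge p (wedge q r) D"
  proof (cases "finite D")
    case fin: True
    let ?f = "\<lambda>(C, A). wsign C (D - C) * (wsign A (C - A) * p A * q (C - A)) * r (D - C)"
    let ?g = "\<lambda>(A, B). wsign A (D - A) * p A * (wsign B (D - A - B) * q B * r (D - A - B))"
    have "wedge (wedge p q) r D = (\<Sum>C\<in>Pow D. \<Sum>A\<in>Pow C. ?f (C, A))"
      unfolding wedge_def by (simp add: sum_distrib_left sum_distrib_right)
    also have "\<dots> = sum ?f (Sigma (Pow D) Pow)"
      using fin by (subst sum.Sigma) (auto intro: finite_subset)
    also have "\<dots> = sum ?g (Sigma (Pow D) (\<lambda>A. Pow (D - A)))"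
    proof (rule sum.reindex_bij_witness[of _ "\<lambda>(A, B). (A \<union> B, A)" "\<lambda>(C, A). (A, C - A)"])
      fix x assume "x \<in> Sigma (Pow D) Pow"
      then obtain C A where x: "x = (C, A)" "A \<subseteq> C" "C \<subseteq> D" by auto
      have f: "finite A" "finite (C - A)" "finite (D - C)"
        using x fin finite_subset by (metis finite_Diff)+
      have 1: "wsign C (D - C) = wsign A (D - C) * wsign (C - A) (D - C)"
        using wsign_Un_left[of A "C - A" "D - C"] f x by (simp add: Un_absorb1)
      have e: "D - A = (C - A) \<union> (D - C)" using x by auto
      have 2: "wsign A (D - A) = wsign A (C - A) * wsign A (D - C)"
        unfolding e by (rule wsign_Un_right) (use f in auto)
      have e': "D - A - (C - A) = D - C" using x by auto
      show "?g (case x of (C, A) \<Rightarrow> (A, C - A)) = ?f x"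
        by (simp add: x(1) 1 2 e')
    qed auto
    also have "\<dots> = (\<Sum>A\<in>Pow D. \<Sum>B\<in>Pow (D - A). ?g (A, B))"
      using fin by (subst sum.Sigma) (auto intro: finite_subset)
    also have "\<dots> = wedge p (wedge q r) D"
      unfolding wedge_def by (simp add: sum_distrib_left)
    finally show ?thesis .
  next
    case False
    then show ?thesis by (simp add: wedge_def)
  qed
qed

lemma wedge_carrier:
  assumes "p \<in> carrier (ext_alg n)" "q \<in> carrier (ext_alg n)"
  shows "wedge p q \<in> carrier (ext_alg n)"
proof -
  have "C \<subseteq> {1..n}" if "wedge p q C \<noteq> 0" for C
  proof -
    from that obtain A where A: "A \<in> Pow C" "wsign A (C - A) * p A * q (C - A) \<noteq> 0"
      unfolding wedge_def by (rule sum.not_neutral_contains_not_neutral)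
    then have "A \<subseteq> {1..n}" "C - A \<subseteq> {1..n}" using assms by (auto simp: ext_alg_def)
    then show ?thesis using A by auto
  qed
  then show ?thesis by (simp add: ext_alg_def)
qed

lemma wedge_distrib:
  "wedge (\<lambda>A. p A + q A) r = (\<lambda>A. wedge p r A + wedge q r A)"
  "wedge r (\<lambda>A. p A + q A) = (\<lambda>A. wedge r p A + wedge r q A)"
  by (simp_all add: wedge_def fun_eq_iff distrib_left distrib_right sum.distrib)

lemma wsign_empty [simp]: "wsign {} A = 1" "wsign A {} = 1"
  by (auto simp: wsign_def)

lemma wedge_one:
  assumes "p \<in> carrier (ext_alg n)"
  shows "wedge (theta {}) p = p" "wedge p (theta {}) = p"
proof -
  have inf: "p C = 0" if "infinite C" for C
    using assms that finite_subset[of C "{1..n}"] by (auto simp: ext_alg_def)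
  show "wedge (theta {}) p = p"
  proof
    fix C
    show "wedge (theta {}) p C = p C"
    proof (cases "finite C")
      case True
      have "wedge (theta {}) p C = (\<Sum>A\<in>Pow C. if A = {} then p C else 0)"
        unfolding wedge_def by (rule sum.cong) (auto simp: theta_def)
      then show ?thesis using True by (simp add: sum.delta)
    qed (simp add: wedge_def inf)
  qed
  show "wedge p (theta {}) = p"
  proof
    fix C
    show "wedge p (theta {}) C = p C"
    proof (cases "finite C")
      case True
      have "wedge p (theta {}) C = (\<Sum>A\<in>Pow C. if A = C then p C else 0)"
        unfolding wedge_def by (rule sum.cong) (auto simp: theta_def)
      then show ?thesis using True by (simp add: sum.delta)
    qed (simp add: wedge_def inf)
  qed
qed

lemma ring_ext_alg: "ring (ext_alg n)"
proof (rule ringI)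
  show "abelian_group (ext_alg n)"
  proof (rule abelian_groupI)
    fix x assume "x \<in> carrier (ext_alg n)"
    then show "\<exists>y\<in>carrier (ext_alg n). y \<oplus>\<^bsub>ext_alg n\<^esub> x = \<zero>\<^bsub>ext_alg n\<^esub>"
      by (intro bexI[of _ "\<lambda>A. - x A"]) (auto simp: ext_alg_def)
  next
    fix x y assume "x \<in> carrier (ext_alg n)" "y \<in> carrier (ext_alg n)"
    then have "A \<subseteq> {1..n}" if "x A + y A \<noteq> 0" for A
      using that by (cases "x A = 0") (simp_all add: ext_alg_def)
    then show "x \<oplus>\<^bsub>ext_alg n\<^esub> y \<in> carrier (ext_alg n)"
      by (simp add: ext_alg_def)
  qed (auto simp: ext_alg_def add_ac)
  show "Group.monoid (ext_alg n)"
  proof (rule monoidI)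
    fix x y assume "x \<in> carrier (ext_alg n)" "y \<in> carrier (ext_alg n)"
    then show "x \<otimes>\<^bsub>ext_alg n\<^esub> y \<in> carrier (ext_alg n)"
      using wedge_carrier[of x n y] by (simp add: ext_alg_def)
  next
    show "\<one>\<^bsub>ext_alg n\<^esub> \<in> carrier (ext_alg n)" by (simp add: ext_alg_def theta_def)
  next
    fix x assume "x \<in> carrier (ext_alg n)"
    then show "\<one>\<^bsub>ext_alg n\<^esub> \<otimes>\<^bsub>ext_alg n\<^esub> x = x" "x \<otimes>\<^bsub>ext_alg n\<^esub> \<one>\<^bsub>ext_alg n\<^esub> = x"
      using wedge_one[of x n] by (simp_all add: ext_alg_def)
  qed (simp add: ext_alg_def wedge_assoc)
qed (simp_all add: ext_alg_def wedge_distrib)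

lemma field_rat: "field (class_ring :: rat ring)"
  by (rule class_field.field_axioms)

lemma cring_rat: "cring (class_ring :: rat ring)"
  by (rule fieldE(1)[OF field_rat])

lemma vectorspace_ext_alg: "vectorspace (class_ring :: rat ring) (ext_alg n)"
proof -
  interpret ring "ext_alg n" by (rule ring_ext_alg)
  have "module (class_ring :: rat ring) (ext_alg n)"
    by (rule moduleI[OF cring_rat abelian_group_axioms])
      (auto simp: ext_alg_def algebra_simps)
  then show ?thesis by (simp add: vectorspace_def field_rat)
qed

lemma F1_carrier: "F1 n r \<in> carrier (ext_alg n)"
proof -
  interpret ring "ext_alg n" by (rule ring_ext_alg)
  show ?thesis unfolding F1_def
    by (rule finsum_closed) (auto simp: ext_alg_def theta_def split: if_splits)
qed

lemma ideal_EQI: "ideal (EQI n) (ext_alg n)"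
  unfolding EQI_def
  by (rule ring.genideal_ideal[OF ring_ext_alg]) (use F1_carrier in auto)

lemma EQI_smult:
  assumes "p \<in> EQI n"
  shows "c \<odot>\<^bsub>ext_alg n\<^esub> p \<in> EQI n"
proof -
  interpret ideal "EQI n" "ext_alg n" by (rule ideal_EQI)
  let ?c = "\<lambda>A. c * theta {} A"
  have p: "p \<in> carrier (ext_alg n)" using assms a_subset by auto
  have "?c \<in> carrier (ext_alg n)" by (simp add: ext_alg_def theta_def)
  then have "?c \<otimes>\<^bsub>ext_alg n\<^esub> p \<in> EQI n" by (rule I_l_closed[OF assms])
  moreover have "wedge ?c p C = c * wedge (theta {}) p C" for C
    by (simp add: wedge_def sum_distrib_left mult.assoc mult.left_commute)
  then have "?c \<otimes>\<^bsub>ext_alg n\<^esub> p = c \<odot>\<^bsub>ext_alg n\<^esub> p"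
    using wedge_one(1)[OF p] by (simp add: ext_alg_def fun_eq_iff)
  ultimately show ?thesis by simp
qed

lemma vectorspace_EQH: "vectorspace (class_ring :: rat ring) (EQH n)"
proof -
  interpret vectorspace "class_ring :: rat ring" "ext_alg n" by (rule vectorspace_ext_alg)
  have "submodule class_ring {q \<in> carrier (ext_alg n). \<forall>p\<in>EQI n. ext_inner n p q = 0} (ext_alg n)"
  proof (rule submodule.intro)
    show "module class_ring (ext_alg n)" by (rule module_axioms)
    fix v w assume vw: "v \<in> {q \<in> carrier (ext_alg n). \<forall>p\<in>EQI n. ext_inner n p q = 0}"
      "w \<in> {q \<in> carrier (ext_alg n). \<forall>p\<in>EQI n. ext_inner n p q = 0}"
    then have "v \<oplus>\<^bsub>ext_alg n\<^esub> w \<in> carrier (ext_alg n)" by simp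
    moreover have "v \<oplus>\<^bsub>ext_alg n\<^esub> w = (\<lambda>A. v A + w A)" by (simp add: ext_alg_def)
    ultimately show "v \<oplus>\<^bsub>ext_alg n\<^esub> w \<in> {q \<in> carrier (ext_alg n). \<forall>p\<in>EQI n. ext_inner n p q = 0}"
      using vw by (simp add: ext_inner_eq algebra_simps sum.distrib)
  next
    fix c :: rat and v
    assume v: "v \<in> {q \<in> carrier (ext_alg n). \<forall>p\<in>EQI n. ext_inner n p q = 0}"
    then have "c \<odot>\<^bsub>ext_alg n\<^esub> v \<in> carrier (ext_alg n)" by simp
    moreover have "c \<odot>\<^bsub>ext_alg n\<^esub> v = (\<lambda>A. c * v A)" by (simp add: ext_alg_def)
    moreover have "(\<Sum>A\<in>Pow {1..n}. p A * (c * v A)) = c * (\<Sum>A\<in>Pow {1..n}. p A * v A)" for p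
      by (simp add: sum_distrib_left mult.left_commute)
    ultimately show "c \<odot>\<^bsub>ext_alg n\<^esub> v \<in> {q \<in> carrier (ext_alg n). \<forall>p\<in>EQI n. ext_inner n p q = 0}"
      using v by (simp add: ext_inner_eq)
  next
    have "\<zero>\<^bsub>ext_alg n\<^esub> = (\<lambda>_. 0)" by (simp add: ext_alg_def)
    moreover have "\<zero>\<^bsub>ext_alg n\<^esub> \<in> carrier (ext_alg n)" by simp
    ultimately show "\<zero>\<^bsub>ext_alg n\<^esub> \<in> {q \<in> carrier (ext_alg n). \<forall>p\<in>EQI n. ext_inner n p q = 0}"
      by (simp add: ext_inner_eq)
  qed auto
  then show ?thesis unfolding EQH_def
    by (intro subspace_is_vs) (auto simp: subspace_def vectorspace_axioms)
qed

lemma EQC_simps: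
  "carrier (EQC n) = EQproj n ` carrier (ext_alg n)"
  "add (EQC n) = set_add (ext_alg n)"
  "\<zero>\<^bsub>EQC n\<^esub> = EQI n"
  by (auto simp: EQC_def ring.defs FactRing_def EQproj_def A_RCOSETS_def RCOSETS_def a_r_coset_def)

lemma EQproj_add:
  assumes "p \<in> carrier (ext_alg n)" "q \<in> carrier (ext_alg n)"
  shows "EQproj n p \<oplus>\<^bsub>EQC n\<^esub> EQproj n q = EQproj n (p \<oplus>\<^bsub>ext_alg n\<^esub> q)"
proof -
  interpret ideal "EQI n" "ext_alg n" by (rule ideal_EQI)
  show ?thesis using assms by (simp add: EQC_simps EQproj_def a_rcos_sum)
qed

lemma EQproj_smult:
  assumes p: "p \<in> carrier (ext_alg n)"
  shows "c \<odot>\<^bsub>EQC n\<^esub> EQproj n p = EQproj n (c \<odot>\<^bsub>ext_alg n\<^esub> p)"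
proof -
  interpret ideal "EQI n" "ext_alg n" by (rule ideal_EQI)
  interpret V: vectorspace "class_ring :: rat ring" "ext_alg n" by (rule vectorspace_ext_alg)
  have cl: "c \<odot>\<^bsub>ext_alg n\<^esub> x \<in> carrier (ext_alg n)" if "x \<in> carrier (ext_alg n)" for x
    using that by simp
  have "EQproj n (c \<odot>\<^bsub>ext_alg n\<^esub> x) = EQproj n (c \<odot>\<^bsub>ext_alg n\<^esub> p)" if x: "x \<in> EQproj n p" for x
  proof -
    from x obtain h where h: "h \<in> EQI n" "x = h \<oplus>\<^bsub>ext_alg n\<^esub> p"
      by (auto simp: EQproj_def a_r_coset_def')
    have hc: "h \<in> carrier (ext_alg n)" using h a_subset by auto
    have "c \<odot>\<^bsub>ext_alg n\<^esub> x = c \<odot>\<^bsub>ext_alg n\<^esub> h \<oplus>\<^bsub>ext_alg n\<^esub> c \<odot>\<^bsub>ext_alg n\<^esub> p"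
      using V.smult_r_distr[of c h p] hc p h(2) by simp
    then have "c \<odot>\<^bsub>ext_alg n\<^esub> x \<in> EQproj n (c \<odot>\<^bsub>ext_alg n\<^esub> p)"
      using EQI_smult[OF h(1)] by (auto simp: EQproj_def a_r_coset_def')
    then show ?thesis unfolding EQproj_def
      using a_repr_independence[OF _ cl[OF p]] a_subgroup by metis
  qed
  moreover have "p \<in> EQproj n p" unfolding EQproj_def using p by (rule a_rcos_self)
  ultimately have "(\<Union>x\<in>EQproj n p. EQproj n (c \<odot>\<^bsub>ext_alg n\<^esub> x)) = EQproj n (c \<odot>\<^bsub>ext_alg n\<^esub> p)"
    by blast
  then show ?thesis by (simp add: EQC_def ring.defs)
qed

lemma vectorspace_EQC: "vectorspace (class_ring :: rat ring) (EQC n)"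
proof -
  interpret ideal "EQI n" "ext_alg n" by (rule ideal_EQI)
  interpret V: vectorspace "class_ring :: rat ring" "ext_alg n" by (rule vectorspace_ext_alg)
  interpret Q: ring "ext_alg n Quot EQI n" by (rule quotient_is_ring)
  have eq: "carrier (EQC n) = carrier (ext_alg n Quot EQI n)"
    "add (EQC n) = add (ext_alg n Quot EQI n)" "\<zero>\<^bsub>EQC n\<^esub> = \<zero>\<^bsub>ext_alg n Quot EQI n\<^esub>"
    by (simp_all add: EQC_def ring.defs)
  have ab: "abelian_group (EQC n)"
    by (rule abelian_groupI) (simp_all add: eq Q.a_assoc Q.add.l_inv_ex[simplified], rule Q.a_comm)
  have "module (class_ring :: rat ring) (EQC n)"
  proof (rule moduleI[OF cring_rat ab])
    fix a b :: rat and X assume "X \<in> carrier (EQC n)"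
    then obtain p where p: "p \<in> carrier (ext_alg n)" "X = EQproj n p" by (auto simp: EQC_simps)
    have cl: "c \<odot>\<^bsub>ext_alg n\<^esub> p \<in> carrier (ext_alg n)" for c using p by simp
    show "a \<odot>\<^bsub>EQC n\<^esub> X \<in> carrier (EQC n)"
      using p cl by (simp add: EQproj_smult EQC_simps(1))
    show "(a \<oplus>\<^bsub>class_ring\<^esub> b) \<odot>\<^bsub>EQC n\<^esub> X = a \<odot>\<^bsub>EQC n\<^esub> X \<oplus>\<^bsub>EQC n\<^esub> b \<odot>\<^bsub>EQC n\<^esub> X"
      using p cl V.smult_l_distr[of a b p] by (simp add: EQproj_smult EQproj_add)
    show "(a \<otimes>\<^bsub>class_ring\<^esub> b) \<odot>\<^bsub>EQC n\<^esub> X = a \<odot>\<^bsub>EQC n\<^esub> (b \<odot>\<^bsub>EQC n\<^esub> X)"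
      using p cl V.smult_assoc1[of a b p] by (simp add: EQproj_smult)
    show "\<one>\<^bsub>class_ring\<^esub> \<odot>\<^bsub>EQC n\<^esub> X = X"
      using p V.smult_one[of p] by (simp add: EQproj_smult)
    fix Y assume "Y \<in> carrier (EQC n)"
    then obtain q where q: "q \<in> carrier (ext_alg n)" "Y = EQproj n q" by (auto simp: EQC_simps)
    then show "a \<odot>\<^bsub>EQC n\<^esub> (X \<oplus>\<^bsub>EQC n\<^esub> Y) = a \<odot>\<^bsub>EQC n\<^esub> X \<oplus>\<^bsub>EQC n\<^esub> a \<odot>\<^bsub>EQC n\<^esub> Y"
      using p V.smult_r_distr[of a p q] by (simp add: EQproj_smult EQproj_add)
  qed
  then show ?thesis by (simp add: vectorspace_def field_rat)
qed

end

(*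
  Left multiplication by F_{1^r} has an adjoint Fadj n r, and F_{1^r} commutes with every monomial
  up to sign, so EQH_n is the common kernel of the operators Fadj n r with r >= 1.

  Delta lies in EQH_n: the sum of t^r Fadj n r over r is the ordered product of the operators
  1 + t d_i, and the two factors belonging to a matched pair (i, j) fix (theta_j - theta_i) g once
  everything between i and j has been removed; the remaining factors pass through theta_j - theta_i
  after replacing t by -t.

  EQH_n is no larger: an element of EQH_n whose coefficients at all ballot sets vanish is zero.
  By induction on n this reduces to the vanishing of EQH_n in degrees above n/2, i.e. to the
  injectivity of d_{1^2} = sum of d_j d_i over i < j on 2h variables in degrees above h. That is an
  sl_2 argument: the form sum of (-1)^(j-i) theta_i theta_j, which up to sign is inverse to the
  all-one form, has commutator (degree - h) with d_{1^2}.

  Since Delta has the set of closing positions as unique monomial of maximal weight, where the weight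
  of a set is the sum of its elements, the two facts give the basis of EQH_n. The quotient EQC_n
  follows from R_n being the orthogonal sum of I_n and EQH_n.
*)
theory Submission
  imports Defs "HOL-Library.Function_Algebras" "HOL-Computational_Algebra.Polynomial"
begin

section \<open>Multiplication and differentiation operators\<close>

text \<open>Rewriting with these rules leaves pointwise lambda terms to which the linearity rules of the
  operators below no longer apply.\<close>

lemmas pointwise_apply = plus_fun_apply zero_fun_apply minus_apply uminus_apply

text \<open>The sign of moving \<open>\<theta>\<^sub>k\<close> past the smaller factors of a
  monomial. Only finitely many indices lie below k, so the sign rules hold for infinite B
  too.\<close>

definition sg :: "nat \<Rightarrow> nat set \<Rightarrow> rat" where
  "sg k B = (- 1) ^ card {j \<in> B. j < k}"

lemma sg_insert:
  "sg k (insert l B) = (if l < k \<and> l \<notin> B then - sg k B else sg k B)"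
proof -
  have fin: "finite {j \<in> B. j < k}" by (rule finite_subset[of _ "{..<k}"]) auto
  have "{j \<in> insert l B. j < k} = (if l < k then insert l {j \<in> B. j < k} else {j \<in> B. j < k})"
    by auto
  then show ?thesis using fin by (auto simp: sg_def insert_absorb)
qed

lemma sg_Diff:
  "sg k (B - {l}) = (if l < k \<and> l \<in> B then - sg k B else sg k B)"
proof (cases "l \<in> B")
  case True
  then have "insert l (B - {l}) = B" by auto
  then show ?thesis using True sg_insert[of k l "B - {l}"] by (auto split: if_splits)
qed simp

lemma sg_square [simp]: "sg k B * sg k B = 1" "sg k B * (sg k B * x) = x"
proof -
  show "sg k B * sg k B = 1" by (simp add: sg_def flip: power_mult_distrib)
  then show "sg k B * (sg k B * x) = x" by (metis mult.assoc mult_1)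
qed

text \<open>Left multiplication by \<open>\<theta>\<^sub>k\<close>. On infinite sets, where \<^const>\<open>wedge\<close> is zero by junk convention, it is
  extended by the same formula, so that the relations with \<^const>\<open>dtheta\<close> hold without side
  conditions.\<close>

definition tmul :: "nat \<Rightarrow> ext \<Rightarrow> ext" where
  "tmul k p = (\<lambda>B. if k \<in> B then sg k B * p (B - {k}) else 0)"

section \<open>Canonical anticommutation relations\<close>

lemma dtheta_alt: "dtheta i p = (\<lambda>B. if i \<in> B then 0 else sg i B * p (insert i B))"
  unfolding dtheta_def sg_def ..

lemma dtheta_linear [simp]:
  "dtheta i (p + q) = dtheta i p + dtheta i q"
  "dtheta i (p - q) = dtheta i p - dtheta i q"
  "dtheta i (- p) = - dtheta i p"
  "dtheta i 0 = 0"
  by (auto simp: dtheta_alt fun_eq_iff algebra_simps)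

lemma tmul_linear [simp]:
  "tmul i (p + q) = tmul i p + tmul i q"
  "tmul i (p - q) = tmul i p - tmul i q"
  "tmul i (- p) = - tmul i p"
  "tmul i 0 = 0"
  by (auto simp: tmul_def fun_eq_iff algebra_simps)

lemma dtheta_square [simp]: "dtheta i (dtheta i p) = 0"
  by (auto simp: dtheta_alt fun_eq_iff)

lemma tmul_square [simp]: "tmul i (tmul i p) = 0"
  by (auto simp: tmul_def fun_eq_iff)

lemma dtheta_anticomm: "dtheta i (dtheta j p) = - dtheta j (dtheta i p)"
  by (cases i j rule: linorder_cases)
    (auto simp: dtheta_alt fun_eq_iff sg_insert insert_commute)

lemma tmul_anticomm: "tmul i (tmul j p) = - tmul j (tmul i p)"
proof (cases "i = j")
  case False
  have "B - {i} - {j} = B - {j} - {i}" for B :: "nat set" by auto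
  then show ?thesis using False
    by (cases i j rule: linorder_cases) (auto simp: tmul_def fun_eq_iff sg_Diff)
qed simp

lemma dtheta_tmul: "i \<noteq> k \<Longrightarrow> dtheta i (tmul k p) = - tmul k (dtheta i p)"
  by (cases i k rule: linorder_cases)
    (auto simp: tmul_def dtheta_alt fun_eq_iff sg_Diff sg_insert insert_Diff_if)

lemma dtheta_tmul_same: "dtheta i (tmul i p) = p - tmul i (dtheta i p)"
  by (auto simp: tmul_def dtheta_alt fun_eq_iff sg_Diff sg_insert insert_absorb)

lemma wedge_theta_left: "finite B \<Longrightarrow> wedge (theta {k}) p B = tmul k p B"
proof -
  assume B: "finite B"
  have "wedge (theta {k}) p B =
     (\<Sum>A\<in>Pow B. if A = {k} then wsign {k} (B - {k}) * p (B - {k}) else 0)"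
    unfolding wedge_def by (rule sum.cong) (auto simp: theta_def)
  also have "\<dots> = (if k \<in> B then wsign {k} (B - {k}) * p (B - {k}) else 0)"
    using B by (simp add: sum.delta)
  also have "wsign {k} (B - {k}) = sg k B"
  proof -
    have "{(a, b). a \<in> {k} \<and> b \<in> B - {k} \<and> b < a} = (\<lambda>j. (k, j)) ` {j \<in> B. j < k}" by auto
    moreover have "card \<dots> = card {j \<in> B. j < k}" by (rule card_image) (simp add: inj_on_def)
    ultimately show ?thesis by (simp only: wsign_def sg_def)
  qed
  finally show ?thesis by (simp add: tmul_def)
qed

text \<open>Removing k pairs the sets that contain k with those that avoid it. The sign
  \<open>sg k\<close> looks strictly below k, so both sides carry the same one.\<close>

lemma ext_inner_tmul:
  assumes "k \<in> {1..N}"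
  shows "ext_inner N (tmul k p) q = ext_inner N p (dtheta k q)"
proof -
  let ?X = "Pow {1..N}"
  have "ext_inner N (tmul k p) q = (\<Sum>A\<in>{A\<in>?X. k \<in> A}. sg k A * p (A - {k}) * q A)"
    unfolding ext_inner_eq by (rule sum.mono_neutral_cong_right) (auto simp: tmul_def)
  also have "\<dots> = (\<Sum>B\<in>{B\<in>?X. k \<notin> B}. sg k B * p B * q (insert k B))"
    by (rule sum.reindex_bij_witness[of _ "insert k" "\<lambda>A. A - {k}"])
      (use assms in \<open>auto simp: sg_Diff insert_absorb\<close>)
  also have "\<dots> = ext_inner N p (dtheta k q)"
    unfolding ext_inner_eq
    by (rule sum.mono_neutral_cong_left) (auto simp: dtheta_alt)
  finally show ?thesis .
qed

section \<open>Adjoints of the generators and the degree bound\<close>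

definition scale :: "rat \<Rightarrow> ext \<Rightarrow> ext" where
  "scale c p = (\<lambda>A. c * p A)"

lemma scale_simps [simp]:
  "scale c (p + q) = scale c p + scale c q"
  "scale c (p - q) = scale c p - scale c q"
  "scale c (- p) = - scale c p"
  "scale c 0 = 0"
  "scale 0 p = 0"
  "scale (a + b) p = scale a p + scale b p"
  "scale (a - b) p = scale a p - scale b p"
  "scale 1 p = p"
  by (auto simp: scale_def fun_eq_iff algebra_simps)

lemma scale_dtheta [simp]: "dtheta i (scale c p) = scale c (dtheta i p)"
  by (auto simp: scale_def dtheta_alt fun_eq_iff)

lemma scale_tmul [simp]: "tmul i (scale c p) = scale c (tmul i p)"
  by (auto simp: scale_def tmul_def fun_eq_iff)

text \<open>The adjoint of left multiplication by \<open>F1 n r\<close> (lemma \<open>ext_inner_F1\<close>); the recursion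
  splits the sets counted by \<open>F1 (Suc n) (Suc r)\<close> according to whether they contain \<open>Suc n\<close>.\<close>

fun Fadj :: "nat \<Rightarrow> nat \<Rightarrow> ext \<Rightarrow> ext" where
  "Fadj n 0 q = q"
| "Fadj 0 (Suc r) q = 0"
| "Fadj (Suc n) (Suc r) q = Fadj n (Suc r) q + dtheta (Suc n) (Fadj n r q)"

lemma Fadj_linear [simp]:
  "Fadj n r (p + q) = Fadj n r p + Fadj n r q"
  "Fadj n r (p - q) = Fadj n r p - Fadj n r q"
  "Fadj n r (- p) = - Fadj n r p"
  "Fadj n r 0 = 0"
  by (induction n r p rule: Fadj.induct) simp_all

text \<open>\<open>Fadj n r\<close> is a sum of products of r derivatives with indices at most n;
  each of them anticommutes with \<open>dtheta k\<close>.\<close>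

lemma Fadj_dtheta:
  "n < k \<Longrightarrow> Fadj n r (dtheta k q) =
    (if even r then dtheta k (Fadj n r q) else - dtheta k (Fadj n r q))"
  by (induction n r q rule: Fadj.induct) (auto simp: dtheta_anticomm[of _ k])

text \<open>The variables are adjoined in pairs because the all-one skew form is nondegenerate only in even
  dimension. With \<open>s = \<Sum>\<partial>\<^sub>i\<close> (\<open>psum\<close>), \<open>D = \<Sum>\<partial>\<^sub>j\<partial>\<^sub>i\<close> for \<open>i < j\<close> (\<open>pform\<close>),
  \<open>A = \<Sum>(-1)\<^sup>i\<theta>\<^sub>i\<close> (\<open>alt_mul\<close>) and the quadratic \<open>W\<close> (\<open>raising\<close>), the relations
  \<open>sA + As = 0\<close>, \<open>[D, A] = -s\<close> and \<open>[s, W] = -A\<close> are what makes the induction for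
  \<open>[D, W] = deg - h\<close> close.\<close>

fun alt_mul :: "nat \<Rightarrow> ext \<Rightarrow> ext" where
  "alt_mul 0 p = 0"
| "alt_mul (Suc h) p = alt_mul h p - tmul (2*h+1) p + tmul (2*h+2) p"

fun raising :: "nat \<Rightarrow> ext \<Rightarrow> ext" where
  "raising 0 p = 0"
| "raising (Suc h) p = raising h p + alt_mul h (tmul (2*h+2) p - tmul (2*h+1) p)
     - tmul (2*h+1) (tmul (2*h+2) p)"

fun number :: "nat \<Rightarrow> ext \<Rightarrow> ext" where
  "number 0 p = 0"
| "number (Suc h) p = number h p + tmul (2*h+1) (dtheta (2*h+1) p) + tmul (2*h+2) (dtheta (2*h+2) p)"

fun psum :: "nat \<Rightarrow> ext \<Rightarrow> ext" where
  "psum 0 p = 0"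
| "psum (Suc h) p = psum h p + dtheta (2*h+1) p + dtheta (2*h+2) p"

fun pform :: "nat \<Rightarrow> ext \<Rightarrow> ext" where
  "pform 0 p = 0"
| "pform (Suc h) p = pform h p + dtheta (2*h+1) (psum h p) + dtheta (2*h+2) (psum h p)
    + dtheta (2*h+2) (dtheta (2*h+1) p)"

section \<open>Commutation relations behind the sl_2 action\<close>

lemma psum_linear [simp]:
  "psum h (p + q) = psum h p + psum h q"
  "psum h (p - q) = psum h p - psum h q"
  "psum h (- p) = - psum h p"
  "psum h 0 = 0"
  by (induction h) (auto simp: algebra_simps)

lemma pform_linear [simp]:
  "pform h (p + q) = pform h p + pform h q"
  "pform h (p - q) = pform h p - pform h q"
  "pform h (- p) = - pform h p"
  "pform h 0 = 0"
  by (induction h) (auto simp: algebra_simps)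

lemma alt_mul_linear [simp]:
  "alt_mul h (p + q) = alt_mul h p + alt_mul h q"
  "alt_mul h (p - q) = alt_mul h p - alt_mul h q"
  "alt_mul h (- p) = - alt_mul h p"
  "alt_mul h 0 = 0"
  by (induction h) (auto simp: algebra_simps)

lemma raising_linear [simp]:
  "raising h (p + q) = raising h p + raising h q"
  "raising h (p - q) = raising h p - raising h q"
  "raising h (- p) = - raising h p"
  "raising h 0 = 0"
  by (induction h) (auto simp: algebra_simps)

lemma number_linear [simp]:
  "number h (p + q) = number h p + number h q"
  "number h (p - q) = number h p - number h q"
  "number h (- p) = - number h p"
  "number h 0 = 0"
  by (induction h) (auto simp: algebra_simps)

text \<open>From here on, operators in the first 2h variables are moved past a new variable. The odd
  ones, \<open>psum\<close> and \<open>alt_mul\<close>, anticommute with it; the even ones,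
  \<open>pform\<close>, \<open>raising\<close> and \<open>number\<close>, commute with it.\<close>

lemma psum_dtheta: "2 * h < k \<Longrightarrow> psum h (dtheta k p) = - dtheta k (psum h p)"
  by (induction h) (auto simp: dtheta_anticomm[of _ k])

lemma psum_tmul: "2 * h < k \<Longrightarrow> psum h (tmul k p) = - tmul k (psum h p)"
  by (induction h) (auto simp: dtheta_tmul)

lemma alt_mul_dtheta: "2 * h < k \<Longrightarrow> dtheta k (alt_mul h p) = - alt_mul h (dtheta k p)"
  by (induction h) (auto simp: dtheta_tmul)

lemma alt_mul_tmul: "2 * h < k \<Longrightarrow> alt_mul h (tmul k p) = - tmul k (alt_mul h p)"
  by (induction h) (auto simp: tmul_anticomm[of _ k])

lemma pform_dtheta: "2 * h < k \<Longrightarrow> pform h (dtheta k p) = dtheta k (pform h p)"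
  by (induction h) (auto simp: dtheta_anticomm[of _ k] psum_dtheta)

lemma pform_tmul: "2 * h < k \<Longrightarrow> pform h (tmul k p) = tmul k (pform h p)"
  by (induction h) (auto simp: dtheta_tmul psum_tmul)

lemma raising_dtheta: "2 * h < k \<Longrightarrow> dtheta k (raising h p) = raising h (dtheta k p)"
  by (induction h) (auto simp: dtheta_tmul alt_mul_dtheta)

lemma raising_tmul: "2 * h < k \<Longrightarrow> raising h (tmul k p) = tmul k (raising h p)"
  by (induction h) (auto simp: tmul_anticomm[of _ k] alt_mul_tmul)

lemma number_dtheta: "2 * h < k \<Longrightarrow> number h (dtheta k p) = dtheta k (number h p)"
  by (induction h) (auto simp: dtheta_tmul dtheta_anticomm[of _ k])

lemma number_tmul: "2 * h < k \<Longrightarrow> number h (tmul k p) = tmul k (number h p)"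
  by (induction h) (auto simp: dtheta_tmul tmul_anticomm[of _ k])

text \<open>The anticommutation rule oriented for the two newly adjoined variables. The unrestricted
  rule would undo itself when used for rewriting.\<close>

lemma dtheta_swap:
  "dtheta (Suc (Suc n)) (dtheta (Suc n) p) = - dtheta (Suc n) (dtheta (Suc (Suc n)) p)"
  by (rule dtheta_anticomm)

lemma tmul_swap: "tmul (Suc (Suc n)) (tmul (Suc n) p) = - tmul (Suc n) (tmul (Suc (Suc n)) p)"
  by (rule tmul_anticomm)

lemmas move_rules = dtheta_swap tmul_swap psum_dtheta psum_tmul alt_mul_dtheta alt_mul_tmul
  pform_dtheta pform_tmul raising_dtheta raising_tmul number_dtheta number_tmul

lemma psum_psum: "psum h (psum h p) = 0"
  by (induction h arbitrary: p)
    (auto simp: move_rules)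

lemma psum_alt_mul: "psum h (alt_mul h p) = - alt_mul h (psum h p)"
  by (induction h arbitrary: p)
    (auto simp: move_rules dtheta_tmul dtheta_tmul_same)

lemma pform_alt_mul: "pform h (alt_mul h p) = alt_mul h (pform h p) - psum h p"
  by (induction h arbitrary: p)
    (auto simp: move_rules dtheta_tmul dtheta_tmul_same psum_alt_mul)

lemma psum_raising: "psum h (raising h p) = raising h (psum h p) - alt_mul h p"
  by (induction h arbitrary: p)
    (auto simp: move_rules dtheta_tmul dtheta_tmul_same psum_alt_mul)

text \<open>Together with \<open>number_raising\<close> this gives the sl_2 relations. Each adjoined
  pair of variables contributes its own degree minus 1, whence the constant h; the mixed terms
  cancel by the preceding commutators.\<close>

lemma pform_raising: "pform h (raising h p) = raising h (pform h p) + number h p - scale (of_nat h) p"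
  by (induction h arbitrary: p)
    (auto simp: move_rules dtheta_tmul dtheta_tmul_same psum_alt_mul pform_alt_mul psum_raising psum_psum
      algebra_simps)

lemma number_alt_mul: "number h (alt_mul h p) = alt_mul h (number h p) + alt_mul h p"
  by (induction h arbitrary: p)
    (auto simp: move_rules dtheta_tmul dtheta_tmul_same)

lemma number_raising: "number h (raising h p) = raising h (number h p) + raising h p + raising h p"
  by (induction h arbitrary: p)
    (auto simp: move_rules dtheta_tmul dtheta_tmul_same number_alt_mul)

lemma psum_eq_Fadj: "psum h p = Fadj (2 * h) (Suc 0) p"
  by (induction h) simp_all

lemma pform_eq_Fadj: "pform h p = Fadj (2 * h) (Suc (Suc 0)) p"
  by (induction h) (simp_all add: psum_eq_Fadj algebra_simps)

section \<open>Strings of raised vectors and injectivity of the quadratic operator\<close>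

lemma number_apply: "number h p B = of_nat (card (B \<inter> {1..2 * h})) * p B"
proof (induction h)
  case (Suc h)
  have 1: "B \<inter> {1..2 * Suc h} = (B \<inter> {1..2 * h}) \<union> (B \<inter> {2 * h + 1}) \<union> (B \<inter> {2 * h + 2})" by auto
  have 2: "card (B \<inter> {1..2 * Suc h}) =
      card (B \<inter> {1..2 * h}) + card (B \<inter> {2 * h + 1}) + card (B \<inter> {2 * h + 2})"
    unfolding 1 by (subst card_Un_disjoint; (subst card_Un_disjoint)?) auto
  have 3: "tmul i (dtheta i p) B = of_nat (card (B \<inter> {i})) * p B" for i
    by (auto simp: tmul_def dtheta_alt sg_Diff insert_absorb)
  show ?case unfolding 2 by (simp add: 3 Suc algebra_simps)
qed simp

lemma raising_scale [simp]: "raising h (scale c p) = scale c (raising h p)"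
proof -
  have "alt_mul h (scale c p) = scale c (alt_mul h p)" for h p
    by (induction h) (simp_all del: pointwise_apply)
  then show ?thesis
    by (induction h) (simp_all del: pointwise_apply)
qed

lemma number_iterate:
  assumes "number h u = scale (of_nat d) u"
  shows "number h ((raising h ^^ k) u) = scale (of_nat (d + 2 * k)) ((raising h ^^ k) u)"
proof (induction k)
  case (Suc k)
  let ?w = "(raising h ^^ k) u"
  have "number h (raising h ?w) =
      scale (of_nat (d + 2 * k)) (raising h ?w) + raising h ?w + raising h ?w"
    unfolding number_raising Suc by (simp only: raising_scale)
  then show ?case by (auto simp: scale_def fun_eq_iff algebra_simps)
qed (simp add: assms)

text \<open>The string computation for a vector annihilated by D. The constant starts at d - h, and
  passing to the next power W^(k+1) adds d + 2k - h; all of these are positive once d > h.\<close>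

lemma pform_iterate:
  assumes "number h u = scale (of_nat d) u" "pform h u = 0" "h < d"
  shows "\<exists>c>0. pform h ((raising h ^^ Suc k) u) = scale c ((raising h ^^ k) u)"
proof (induction k)
  case 0
  have "pform h (raising h u) = scale (of_nat d - of_nat h) u"
    using assms by (simp add: pform_raising)
  then show ?case using assms(3) by (intro exI[of _ "of_nat d - of_nat h"]) simp
next
  case (Suc k)
  let ?w = "(raising h ^^ Suc k) u"
  obtain c where c: "c > 0" "pform h ?w = scale c ((raising h ^^ k) u)" using Suc by blast
  have "pform h (raising h ?w) = raising h (pform h ?w) + number h ?w - scale (of_nat h) ?w"
    by (rule pform_raising)
  also have "\<dots> = scale c ?w + scale (of_nat (d + 2 * Suc k)) ?w - scale (of_nat h) ?w"
    unfolding c(2) number_iterate[OF assms(1)] by simp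
  also have "\<dots> = scale (c + of_nat (d + 2 * Suc k) - of_nat h) ?w"
    by (simp only: scale_simps)
  finally show ?case
    using c(1) assms(3) by (intro exI[of _ "c + of_nat (d + 2 * Suc k) - of_nat h"]) simp
qed

text \<open>By \<open>pform_iterate\<close> a nonzero u would have all W^k u nonzero. But W^(h+1) u
  has degree d + 2h + 2, which exceeds the number 2h of variables.\<close>

lemma pform_injective:
  assumes "number h u = scale (of_nat d) u" "pform h u = 0" "h < d"
  shows "u = 0"
proof -
  have "(raising h ^^ k) u = 0 \<Longrightarrow> u = 0" for k
  proof (induction k)
    case (Suc k)
    obtain c where "c > 0" "pform h ((raising h ^^ Suc k) u) = scale c ((raising h ^^ k) u)"
      using pform_iterate[OF assms] by blast
    then have "c * ((raising h ^^ k) u) B = 0" for B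
      using Suc.prems by (metis pform_linear(4) scale_def zero_fun_apply)
    then have "(raising h ^^ k) u = 0" using \<open>c > 0\<close> by (simp add: fun_eq_iff)
    then show ?case by (rule Suc.IH)
  qed simp
  moreover have "(raising h ^^ Suc h) u = 0"
  proof
    fix B
    let ?w = "(raising h ^^ Suc h) u"
    have "of_nat (card (B \<inter> {1..2 * h})) * ?w B = of_nat (d + 2 * Suc h) * ?w B"
      using number_iterate[OF assms(1), of "Suc h"] number_apply[of h ?w B] by (metis scale_def)
    moreover have "card (B \<inter> {1..2 * h}) \<le> 2 * h"
      using card_mono[of "{1..2 * h}" "B \<inter> {1..2 * h}"] by simp
    then have "card (B \<inter> {1..2 * h}) \<noteq> d + 2 * Suc h" by simp
    ultimately show "?w B = 0 B"
      by (metis mult_cancel_right of_nat_eq_iff zero_fun_apply)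
  qed
  ultimately show ?thesis by blast
qed

section \<open>The bound on degrees in EQH_n\<close>

definition degree_part :: "nat \<Rightarrow> nat \<Rightarrow> ext \<Rightarrow> ext" where
  "degree_part m d u = (\<lambda>B. if card (B \<inter> {1..m}) = d then u B else 0)"

lemma degree_part_linear [simp]:
  "degree_part m d (p + q) = degree_part m d p + degree_part m d q"
  "degree_part m d 0 = 0"
  by (auto simp: degree_part_def)

lemma degree_part_dtheta:
  assumes "i \<in> {1..m}"
  shows "dtheta i (degree_part m (Suc d) u) = degree_part m d (dtheta i u)"
proof
  fix B
  have "card (insert i B \<inter> {1..m}) = Suc (card (B \<inter> {1..m}))" if "i \<notin> B"
  proof -
    have "insert i B \<inter> {1..m} = insert i (B \<inter> {1..m})" using assms by auto
    then show ?thesis using that by simp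
  qed
  then show "dtheta i (degree_part m (Suc d) u) B = degree_part m d (dtheta i u) B"
    by (auto simp: dtheta_alt degree_part_def)
qed

lemma degree_part_Fadj: "n \<le> m \<Longrightarrow> Fadj n r (degree_part m (d + r) u) = degree_part m d (Fadj n r u)"
proof (induction n r u arbitrary: d rule: Fadj.induct)
  case (3 n r u)
  have "Fadj n r (degree_part m (d + Suc r) u) = degree_part m (Suc d) (Fadj n r u)"
    using 3(2)[of "Suc d"] 3(3) by simp
  then show ?case using 3(1)[of d] 3(3) by (simp add: degree_part_dtheta del: pointwise_apply)
qed (simp_all del: pointwise_apply)

text \<open>\<open>Fadj\<close> is homogeneous, so every homogeneous component of u is again in the
  kernel, and \<open>pform_injective\<close> applies to it. Degree is counted in the first 2h
  variables only, since \<open>degree_bound\<close> uses this with one further variable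
  present.\<close>

lemma Fadj_even_vanish:
  assumes "Fadj (2 * h) 2 u = 0" "h < card (B \<inter> {1..2 * h})"
  shows "u B = 0"
proof -
  let ?d = "card (B \<inter> {1..2 * h})"
  have "h \<noteq> 0" using assms(2) by (cases h) auto
  then have d: "?d = (?d - 2) + 2" using assms(2) by simp
  have "degree_part (2 * h) ?d u = 0"
  proof (rule pform_injective[OF _ _ assms(2)])
    show "number h (degree_part (2 * h) ?d u) = scale (of_nat ?d) (degree_part (2 * h) ?d u)"
      by (auto simp: fun_eq_iff number_apply scale_def degree_part_def)
    show "pform h (degree_part (2 * h) ?d u) = 0"
      using degree_part_Fadj[of "2 * h" "2 * h" 2 "?d - 2" u] assms(1) d
      by (simp add: pform_eq_Fadj numeral_2_eq_2)
  qed
  then have "degree_part (2 * h) ?d u B = 0" by simp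
  then show ?thesis by (simp add: degree_part_def)
qed

lemma Fadj_Suc_0_apply: "(\<And>i. i \<in> {1..n} \<Longrightarrow> dtheta i q B = 0) \<Longrightarrow> Fadj n (Suc 0) q B = 0"
  by (induction n) simp_all

text \<open>For even n this is \<open>Fadj_even_vanish\<close>. For n = 2h + 1 the linear condition
  reads d_n q = - s q, with s the sum of the first 2h derivatives; as d_n d_n = 0, the quadratic
  condition then holds in the first 2h variables alone. So a set A in the support with more than n/2
  elements must contain n. Its coefficient is, up to sign, that of s q at A - {n}, hence a
  combination of coefficients already known to vanish.\<close>

lemma degree_bound:
  assumes "\<And>A. q A \<noteq> 0 \<Longrightarrow> A \<subseteq> {1..n}" "Fadj n 1 q = 0" "Fadj n 2 q = 0" "n < 2 * card A"
  shows "q A = 0"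
proof (cases "even n")
  case True
  then obtain h where n: "n = 2 * h" by blast
  show ?thesis
  proof (rule ccontr)
    assume "q A \<noteq> 0"
    then have "A \<inter> {1..2 * h} = A" using assms(1) n by blast
    then show False using Fadj_even_vanish[of h q A] assms(3,4) n \<open>q A \<noteq> 0\<close> by simp
  qed
next
  case False
  then obtain h where n: "n = Suc (2 * h)" by (metis oddE Suc_eq_plus1)
  have 1: "Fadj (2 * h) (Suc 0) q = - dtheta n q"
    using assms(2) n by (simp add: eq_neg_iff_add_eq_0)
  have "Fadj (2 * h) (Suc (Suc 0)) q + dtheta n (Fadj (2 * h) (Suc 0) q) = 0"
    using assms(3) n by (simp add: numeral_2_eq_2)
  then have 2: "Fadj (2 * h) 2 q = 0" unfolding 1 by (simp add: numeral_2_eq_2)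
  show ?thesis
  proof (rule ccontr)
    assume nz: "q A \<noteq> 0"
    then have A: "A \<subseteq> {1..n}" by (rule assms(1))
    then have fin: "finite A" using finite_subset by blast
    have low: "card (A \<inter> {1..2 * h}) \<le> h"
      using Fadj_even_vanish[OF 2, of A] nz by (meson not_le)
    have "n \<in> A"
    proof (rule ccontr)
      assume "n \<notin> A"
      then have "A \<inter> {1..2 * h} = A" using A n by (auto simp: atLeastAtMostSuc_conv)
      then show False using low assms(4) n by simp
    qed
    let ?B = "A - {n}"
    have B: "?B \<subseteq> {1..2 * h}" using A n by (auto simp: atLeastAtMostSuc_conv)
    have cB: "card ?B \<ge> h" using \<open>n \<in> A\<close> fin assms(4) n by simp
    have "Fadj (2 * h) (Suc 0) q ?B = 0"
    proof (rule Fadj_Suc_0_apply)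
      fix i assume i: "i \<in> {1..2 * h}"
      have "q (insert i ?B) = 0" if "i \<notin> ?B"
      proof (rule Fadj_even_vanish[OF 2])
        have "insert i ?B \<inter> {1..2 * h} = insert i ?B" using B i by auto
        then show "h < card (insert i ?B \<inter> {1..2 * h})" using that cB fin by simp
      qed
      then show "dtheta i q ?B = 0" by (auto simp: dtheta_alt)
    qed
    then have "dtheta n q ?B = 0" unfolding 1 by simp
    moreover have "sg n A \<noteq> 0" by (simp add: sg_def)
    ultimately show False using \<open>n \<in> A\<close> nz
      by (simp add: dtheta_alt insert_absorb sg_Diff)
  qed
qed

section \<open>Ballot sequences as sets of closing positions, and the vanishing criterion\<close>

definition ballot_set :: "nat \<Rightarrow> nat set \<Rightarrow> bool" where
  "ballot_set n A \<longleftrightarrow> A \<subseteq> {1..n} \<and> (\<forall>r\<le>n. 2 * card (A \<inter> {1..r}) \<le> r)"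

lemma ballot_set_Suc:
  assumes "ballot_set n A"
  shows "ballot_set (Suc n) A"
proof -
  have "2 * card (A \<inter> {1..r}) \<le> r" if "r \<le> Suc n" for r
  proof (cases "r = Suc n")
    case True
    have "A \<inter> {1..Suc n} = A \<inter> {1..n}" using assms by (auto simp: ballot_set_def)
    then show ?thesis using assms True by (auto simp: ballot_set_def)
  qed (use assms that in \<open>simp add: ballot_set_def\<close>)
  then show ?thesis using assms by (auto simp: ballot_set_def)
qed

lemma ballot_set_insert:
  assumes "ballot_set n A" "2 * Suc (card A) \<le> Suc n"
  shows "ballot_set (Suc n) (insert (Suc n) A)"
proof -
  have A: "A \<subseteq> {1..n}" using assms(1) by (simp add: ballot_set_def)
  then have fin: "finite A" using finite_subset by blast
  have "2 * card (insert (Suc n) A \<inter> {1..r}) \<le> r" if "r \<le> Suc n" for r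
  proof (cases "r = Suc n")
    case True
    have "insert (Suc n) A \<inter> {1..Suc n} = insert (Suc n) A" using A by auto
    moreover have "card (insert (Suc n) A) \<le> Suc (card A)" by (rule card_insert_le_m1) auto
    ultimately show ?thesis using assms(2) True by simp
  next
    case False
    then have "insert (Suc n) A \<inter> {1..r} = A \<inter> {1..r}" using that by auto
    then show ?thesis using assms(1) that False by (simp add: ballot_set_def)
  qed
  then show ?thesis using A by (auto simp: ballot_set_def)
qed

text \<open>Induction on n, first for the derivative v of q by the last variable. Adding the last
  index to a ballot set gives either a ballot set or a set too large for
  \<open>degree_bound\<close>, so all ballot coefficients of v vanish and v = 0. Then q itself
  involves only the first n variables.\<close>

lemma zero_of_ballot_coefficients:
  assumes "\<And>A. q A \<noteq> 0 \<Longrightarrow> A \<subseteq> {1..n}" "Fadj n 1 q = 0" "Fadj n 2 q = 0"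
    "\<And>A. ballot_set n A \<Longrightarrow> q A = 0"
  shows "q = 0"
  using assms
proof (induction n arbitrary: q)
  case 0
  have "q A = 0" for A
    using 0(1)[of A] 0(4)[of A] by (cases "A = {}") (auto simp: ballot_set_def)
  then show ?case by (simp add: fun_eq_iff)
next
  case (Suc n)
  let ?v = "dtheta (Suc n) q"
  have 1: "Fadj n (Suc 0) q = - ?v"
    using Suc.prems(2)
    by (simp add: eq_neg_iff_add_eq_0 del: pointwise_apply)
  have "Fadj n (Suc (Suc 0)) q + dtheta (Suc n) (Fadj n (Suc 0) q) = 0"
    using Suc.prems(3) by (simp add: numeral_2_eq_2 del: pointwise_apply)
  then have 2: "Fadj n (Suc (Suc 0)) q = 0" unfolding 1 by simp
  have "?v = 0"
  proof (rule Suc.IH)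
    show "A \<subseteq> {1..n}" if "?v A \<noteq> 0" for A
    proof -
      have "Suc n \<notin> A" "q (insert (Suc n) A) \<noteq> 0"
        using that by (auto simp: dtheta_alt split: if_splits)
      then show ?thesis using Suc.prems(1)[of "insert (Suc n) A"] by (auto simp: atLeastAtMostSuc_conv)
    qed
    show "Fadj n 1 ?v = 0" using Fadj_dtheta[of n "Suc n" 1 q] 1 by simp
    show "Fadj n 2 ?v = 0" using Fadj_dtheta[of n "Suc n" 2 q] 2 by (simp add: numeral_2_eq_2)
    show "?v A = 0" if A: "ballot_set n A" for A
    proof -
      have sub: "A \<subseteq> {1..n}" "Suc n \<notin> A" "finite A"
        using A finite_subset[of A "{1..n}"] by (auto simp: ballot_set_def)
      have "q (insert (Suc n) A) = 0"
      proof (cases "2 * Suc (card A) \<le> Suc n")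
        case True
        then show ?thesis using ballot_set_insert[OF A] Suc.prems(4) by blast
      next
        case False
        then show ?thesis using degree_bound[OF Suc.prems(1-3)] sub by simp
      qed
      then show ?thesis by (simp add: dtheta_alt)
    qed
  qed
  show ?case
  proof (rule Suc.IH)
    show "A \<subseteq> {1..n}" if "q A \<noteq> 0" for A
    proof -
      have "Suc n \<notin> A"
      proof
        assume "Suc n \<in> A"
        moreover have "?v (A - {Suc n}) = 0" using \<open>?v = 0\<close> by simp
        moreover have "sg (Suc n) A \<noteq> 0" by (simp add: sg_def)
        ultimately show False using that by (simp add: dtheta_alt insert_absorb sg_Diff)
      qed
      then show ?thesis using Suc.prems(1)[OF that] by (auto simp: atLeastAtMostSuc_conv)
    qed
    show "Fadj n 1 q = 0" using 1 \<open>?v = 0\<close> by simp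
    show "Fadj n 2 q = 0" using 2 by (simp add: numeral_2_eq_2)
    show "q A = 0" if "ballot_set n A" for A
      using Suc.prems(4) ballot_set_Suc that by blast
  qed
qed

section \<open>The orthogonal complement as a common kernel\<close>

lemma ext_alg_carrier: "p \<in> carrier (ext_alg n) \<longleftrightarrow> (\<forall>A. p A \<noteq> 0 \<longrightarrow> A \<subseteq> {1..n})"
  by (simp add: ext_alg_def)

lemma ext_alg_finite: "p \<in> carrier (ext_alg n) \<Longrightarrow> infinite B \<Longrightarrow> p B = 0"
  using finite_subset[of B "{1..n}"] by (auto simp: ext_alg_carrier)

lemma theta_carrier: "A \<subseteq> {1..n} \<Longrightarrow> theta A \<in> carrier (ext_alg n)"
  by (auto simp: ext_alg_carrier theta_def)

section \<open>The generators and the adjoint of multiplication by them\<close>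

lemma finsum_theta:
  assumes "finite S" "S \<subseteq> Pow {1..n}"
  shows "(\<Oplus>\<^bsub>ext_alg n\<^esub> A\<in>S. theta A) = (\<lambda>B. if B \<in> S then 1 else 0)"
proof -
  interpret ring "ext_alg n" by (rule ring_ext_alg)
  show ?thesis using assms
  proof (induction S)
    case empty
    then show ?case by (simp add: finsum_empty) (simp add: ext_alg_def)
  next
    case (insert A S)
    have "theta B \<in> carrier (ext_alg n)" if "B \<in> insert A S" for B
      using insert.prems that by (intro theta_carrier) auto
    then have "(\<Oplus>\<^bsub>ext_alg n\<^esub> B\<in>insert A S. theta B) =
        theta A \<oplus>\<^bsub>ext_alg n\<^esub> (\<Oplus>\<^bsub>ext_alg n\<^esub> B\<in>S. theta B)"
      using insert.hyps by (intro finsum_insert) auto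
    also have "\<dots> = (\<lambda>B. theta A B + (if B \<in> S then 1 else 0))"
      using insert by (simp add: ext_alg_def)
    also have "\<dots> = (\<lambda>B. if B \<in> insert A S then 1 else 0)"
      using insert.hyps by (auto simp: theta_def fun_eq_iff)
    finally show ?case .
  qed
qed

lemma F1_apply: "F1 n r A = (if A \<subseteq> {1..n} \<and> card A = r then 1 else 0)"
proof -
  have "finite {A. A \<subseteq> {1..n} \<and> card A = r}"
    by (rule finite_subset[of _ "Pow {1..n}"]) auto
  then show ?thesis unfolding F1_def by (subst finsum_theta) auto
qed

lemma F1_0: "F1 n 0 = theta {}"
proof
  fix A
  have "A \<subseteq> {1..n} \<and> card A = 0 \<longleftrightarrow> A = {}"
    using finite_subset[of A "{1..n}"] by auto
  then show "F1 n 0 A = theta {} A" by (simp only: F1_apply theta_def)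
qed

lemma F1_0_Suc: "F1 0 (Suc r) = 0"
proof
  fix A show "F1 0 (Suc r) A = 0 A" by (cases "A = {}") (auto simp: F1_apply)
qed

lemma wedge_theta_right:
  assumes "finite C"
  shows "wedge p (theta {k}) C = (if k \<in> C then wsign (C - {k}) {k} * p (C - {k}) else 0)"
proof -
  define c where "c = (if k \<in> C then wsign (C - {k}) {k} * p (C - {k}) else 0)"
  have "wedge p (theta {k}) C = (\<Sum>A\<in>Pow C. if A = C - {k} then c else 0)"
    unfolding wedge_def
  proof (rule sum.cong[OF refl])
    fix A assume A: "A \<in> Pow C"
    show "wsign A (C - A) * p A * theta {k} (C - A) = (if A = C - {k} then c else 0)"
    proof (cases "A = C - {k} \<and> k \<in> C")
      case True
      then have "C - A = {k}" by blast
      then show ?thesis using True by (simp add: theta_def c_def)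
    next
      case False
      then have "C - A \<noteq> {k}" using A by blast
      moreover have "A = C - {k} \<Longrightarrow> c = 0" using False by (simp add: c_def)
      ultimately show ?thesis by (simp add: theta_def)
    qed
  qed
  also have "\<dots> = c" using assms by (simp add: sum.delta)
  finally show ?thesis by (simp only: c_def)
qed

text \<open>The last index exceeds all others, so its factor can be split off on the right without a
  sign.\<close>

lemma F1_Suc: "F1 (Suc n) (Suc r) = F1 n (Suc r) + wedge (F1 n r) (theta {Suc n})"
proof
  fix C
  show "F1 (Suc n) (Suc r) C = (F1 n (Suc r) + wedge (F1 n r) (theta {Suc n})) C"
  proof (cases "finite C")
    case fin: True
    show ?thesis
    proof (cases "Suc n \<in> C")
      case True
      have s: "C - {Suc n} \<subseteq> {1..n} \<longleftrightarrow> C \<subseteq> {1..Suc n}"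
        using True by (auto simp: atLeastAtMostSuc_conv)
      have w: "wsign (C - {Suc n}) {Suc n} = 1" if "C - {Suc n} \<subseteq> {1..n}"
      proof -
        have "{(a, b). a \<in> C - {Suc n} \<and> b \<in> {Suc n} \<and> b < a} = {}" using that by force
        then show ?thesis unfolding wsign_def by (metis card.empty power_0)
      qed
      have c: "card (C - {Suc n}) = r \<longleftrightarrow> card C = Suc r"
        using True fin by (metis card_Suc_Diff1 nat.inject)
      have "\<not> C \<subseteq> {1..n}" using True by auto
      then show ?thesis using True fin s w c by (simp add: wedge_theta_right F1_apply)
    next
      case False
      then have "C \<subseteq> {1..Suc n} \<longleftrightarrow> C \<subseteq> {1..n}" by (auto simp: atLeastAtMostSuc_conv)
      then show ?thesis using False fin by (simp add: wedge_theta_right F1_apply)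
    qed
  next
    case False
    then have "\<not> C \<subseteq> {1..n}" for n using finite_subset[of C "{1..n}"] by auto
    then show ?thesis using False by (simp add: F1_apply wedge_def)
  qed
qed

lemma ext_inner_add:
  "ext_inner N (p + p') q = ext_inner N p q + ext_inner N p' q"
  "ext_inner N p (q + q') = ext_inner N p q + ext_inner N p q'"
  by (simp_all add: ext_inner_eq algebra_simps sum.distrib)

text \<open>The pairing sees only subsets of {1..N}; the values at infinite sets, where
  \<open>wedge\<close> and \<open>tmul\<close> may differ, do not enter.\<close>

lemma ext_inner_cong:
  "(\<And>A. finite A \<Longrightarrow> p A = p' A) \<Longrightarrow> ext_inner N p q = ext_inner N p' q"
  unfolding ext_inner_eq by (rule sum.cong) (auto dest: finite_subset)

lemma ext_inner_theta: "B \<subseteq> {1..N} \<Longrightarrow> ext_inner N (theta B) q = q B"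
proof -
  assume B: "B \<subseteq> {1..N}"
  have "ext_inner N (theta B) q = (\<Sum>A\<in>Pow {1..N}. if A = B then q B else 0)"
    unfolding ext_inner_eq by (rule sum.cong) (auto simp: theta_def)
  then show ?thesis using B by (simp add: sum.delta)
qed

text \<open>By \<open>F1_Suc\<close> the last factor stands next to p, so its adjoint is the
  outermost derivative, as in the recursion of \<open>Fadj\<close>. N stays fixed while n varies
  because the induction replaces p by its product with the last variable.\<close>

lemma ext_inner_F1:
  assumes "n \<le> N" "p \<in> carrier (ext_alg N)"
  shows "ext_inner N (wedge (F1 n r) p) q = ext_inner N p (Fadj n r q)"
  using assms
proof (induction n r q arbitrary: p rule: Fadj.induct)
  case (1 n q)
  then show ?case by (simp add: F1_0 wedge_one)
next
  case (2 r q)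
  then show ?case by (simp add: F1_0_Suc ext_inner_eq wedge_def)
next
  case (3 n r q)
  have k: "theta {Suc n} \<in> carrier (ext_alg N)" using 3(3) by (intro theta_carrier) auto
  have "wedge (F1 (Suc n) (Suc r)) p = wedge (F1 n (Suc r)) p + wedge (F1 n r) (wedge (theta {Suc n}) p)"
    unfolding F1_Suc plus_fun_def wedge_distrib wedge_assoc by (rule refl)
  then have "ext_inner N (wedge (F1 (Suc n) (Suc r)) p) q =
      ext_inner N p (Fadj n (Suc r) q) + ext_inner N (wedge (theta {Suc n}) p) (Fadj n r q)"
    using 3 k wedge_carrier by (simp add: ext_inner_add)
  also have "ext_inner N (wedge (theta {Suc n}) p) (Fadj n r q) =
      ext_inner N (tmul (Suc n) p) (Fadj n r q)"
    by (rule ext_inner_cong) (rule wedge_theta_left)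
  also have "\<dots> = ext_inner N p (dtheta (Suc n) (Fadj n r q))"
    using 3(3) by (intro ext_inner_tmul) auto
  finally show ?case by (simp only: Fadj.simps(3) ext_inner_add(2))
qed

section \<open>EQH_n as the common kernel: both inclusions\<close>

lemma dtheta_carrier: "q \<in> carrier (ext_alg N) \<Longrightarrow> dtheta i q \<in> carrier (ext_alg N)"
  by (auto simp: ext_alg_carrier dtheta_alt split: if_splits)

lemma Fadj_carrier: "q \<in> carrier (ext_alg N) \<Longrightarrow> Fadj n r q \<in> carrier (ext_alg N)"
proof (induction n r q rule: Fadj.induct)
  case (3 n r q)
  then have 1: "Fadj n (Suc r) q \<in> carrier (ext_alg N)"
    and 2: "dtheta (Suc n) (Fadj n r q) \<in> carrier (ext_alg N)" by (auto intro: dtheta_carrier)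
  have "A \<subseteq> {1..N}" if "Fadj (Suc n) (Suc r) q A \<noteq> 0" for A
  proof -
    from that have "Fadj n (Suc r) q A \<noteq> 0 \<or> dtheta (Suc n) (Fadj n r q) A \<noteq> 0" by auto
    then show ?thesis using 1 2 by (auto simp: ext_alg_carrier)
  qed
  then show ?case by (simp only: ext_alg_carrier) blast
qed (simp_all add: ext_alg_carrier)

lemma Fadj_too_large: "n < r \<Longrightarrow> Fadj n r q = 0"
  by (induction n r q rule: Fadj.induct) simp_all

lemma EQH_carrier:
  "q \<in> carrier (EQH n) \<longleftrightarrow> q \<in> carrier (ext_alg n) \<and> (\<forall>p\<in>EQI n. ext_inner n p q = 0)"
  by (simp add: EQH_def)

text \<open>The product of \<open>F1 n r\<close> with \<open>theta B\<close> lies in the ideal, and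
  its pairing with q is the coefficient of \<open>Fadj n r q\<close> at B.\<close>

lemma EQH_imp_Fadj:
  assumes q: "q \<in> carrier (EQH n)" and r: "0 < r"
  shows "Fadj n r q = 0"
proof (cases "r \<le> n")
  case True
  interpret ideal "EQI n" "ext_alg n" by (rule ideal_EQI)
  have qc: "q \<in> carrier (ext_alg n)" using q by (simp add: EQH_carrier)
  have F: "F1 n r \<in> EQI n"
    unfolding EQI_def using True r F1_carrier by (intro subsetD[OF genideal_self]) auto
  have "Fadj n r q B = 0" for B
  proof (cases "B \<subseteq> {1..n}")
    case True
    have B: "theta B \<in> carrier (ext_alg n)" using True by (rule theta_carrier)
    have "wedge (F1 n r) (theta B) \<in> EQI n"
      using I_r_closed[OF F B] by (simp add: ext_alg_def)
    then have "ext_inner n (wedge (F1 n r) (theta B)) q = 0" using q by (simp add: EQH_carrier)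
    then show ?thesis using ext_inner_F1[OF order_refl B] ext_inner_theta[OF True] by simp
  next
    case False
    then show ?thesis using Fadj_carrier[OF qc] by (auto simp: ext_alg_carrier)
  qed
  then show ?thesis by (simp add: fun_eq_iff)
qed (simp add: Fadj_too_large)

text \<open>Each pair in A \<times> B is an inversion for exactly one of the two orders of
  multiplication.\<close>

lemma wsign_swap:
  assumes "finite A" "finite B" "A \<inter> B = {}"
  shows "wsign A B = (- 1) ^ (card A * card B) * wsign B A"
proof -
  let ?X = "{(a, b). a \<in> A \<and> b \<in> B \<and> b < a}" and ?Y = "{(b, a). b \<in> B \<and> a \<in> A \<and> a < b}"
  let ?Z = "{(a, b). a \<in> A \<and> b \<in> B \<and> a < b}"
  have fin: "finite ?X" "finite ?Z"
    by (rule finite_subset[of _ "A \<times> B"]; use assms in auto)+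
  have "a \<noteq> b" if "a \<in> A" "b \<in> B" for a b using assms(3) that by blast
  then have "A \<times> B = ?X \<union> ?Z" by (auto simp: neq_iff)
  moreover have "card (?X \<union> ?Z) = card ?X + card ?Z"
    using fin by (intro card_Un_disjoint) auto
  moreover have "card ?Z = card ?Y"
    by (rule bij_betw_same_card[of prod.swap], rule bij_betw_byWitness[of _ prod.swap]) auto
  ultimately have "card A * card B = card ?X + card ?Y" by (metis card_cartesian_product)
  then have "(- 1) ^ (card A * card B) * wsign B A = wsign A B * (wsign B A * wsign B A)"
    unfolding wsign_def by (simp only: power_add mult.assoc)
  also have "wsign B A * wsign B A = 1"
    unfolding wsign_def power_mult_distrib[symmetric] by simp
  finally show ?thesis by simp
qed

text \<open>\<open>F1 n r\<close> is homogeneous of degree r, so moving it across a monomial of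
  degree |A| costs the sign (-1)^(|A| r).\<close>

lemma wedge_F1_commute:
  "wedge a (F1 n r) = wedge (F1 n r) (\<lambda>A. (- 1) ^ (card A * r) * a A)"
proof
  fix C
  show "wedge a (F1 n r) C = wedge (F1 n r) (\<lambda>A. (- 1) ^ (card A * r) * a A) C"
  proof (cases "finite C")
    case True
    have "wedge a (F1 n r) C = (\<Sum>B\<in>Pow C. wsign (C - B) B * a (C - B) * F1 n r B)"
      unfolding wedge_def
      by (rule sum.reindex_bij_witness[of _ "\<lambda>B. C - B" "\<lambda>B. C - B"]) (auto simp: double_diff)
    also have "\<dots> = wedge (F1 n r) (\<lambda>A. (- 1) ^ (card A * r) * a A) C"
      unfolding wedge_def
    proof (rule sum.cong[OF refl])
      fix B assume "B \<in> Pow C"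
      then have "finite B" "finite (C - B)" using True finite_subset by auto
      then have "wsign (C - B) B = (- 1) ^ (card (C - B) * card B) * wsign B (C - B)"
        by (intro wsign_swap) auto
      then show "wsign (C - B) B * a (C - B) * F1 n r B =
          wsign B (C - B) * F1 n r B * ((- 1) ^ (card (C - B) * r) * a (C - B))"
        by (auto simp: F1_apply)
    qed
    finally show ?thesis .
  qed (simp add: wedge_def)
qed

text \<open>The ideal is two-sided, so J collects the p all of whose multiples a p b are orthogonal
  to q; this makes J an ideal. A generator lies in J because it can be moved to the front of a p b,
  where its adjoint annihilates q.\<close>

lemma Fadj_imp_EQH:
  assumes q: "q \<in> carrier (ext_alg n)" and F: "\<And>r. 0 < r \<Longrightarrow> Fadj n r q = 0"
  shows "q \<in> carrier (EQH n)"
proof -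
  interpret R: ring "ext_alg n" by (rule ring_ext_alg)
  let ?R = "carrier (ext_alg n)"
  define J where "J = {p \<in> ?R. \<forall>a\<in>?R. \<forall>b\<in>?R. ext_inner n (wedge a (wedge p b)) q = 0}"
  have mul: "x \<otimes>\<^bsub>ext_alg n\<^esub> y = wedge x y" for x y by (simp add: ext_alg_def)
  have add: "x \<oplus>\<^bsub>ext_alg n\<^esub> y = x + y" for x y by (simp add: ext_alg_def plus_fun_def)
  have "ideal J (ext_alg n)"
  proof (rule idealI[OF ring_ext_alg])
    show "subgroup J (add_monoid (ext_alg n))"
    proof (rule R.add.subgroupI)
      show "J \<subseteq> ?R" by (auto simp: J_def)
      have "\<zero>\<^bsub>ext_alg n\<^esub> \<in> J"
      proof -
        have "wedge a (wedge \<zero>\<^bsub>ext_alg n\<^esub> b) = (\<lambda>_. 0)" for a b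
          by (simp add: ext_alg_def wedge_def)
        then show ?thesis by (simp add: J_def ext_inner_eq)
      qed
      then show "J \<noteq> {}" by blast
    next
      fix x assume x: "x \<in> J"
      then have xc: "x \<in> ?R" by (simp add: J_def)
      have eq: "\<ominus>\<^bsub>ext_alg n\<^esub> x = (\<lambda>A. - x A)"
        by (rule R.minus_equality) (use xc in \<open>auto simp: ext_alg_def\<close>)
      have "wedge a (wedge (\<lambda>A. - x A) b) = (\<lambda>A. - wedge a (wedge x b) A)" for a b
        by (simp add: wedge_def sum_negf)
      then have "ext_inner n (wedge a (wedge (\<lambda>A. - x A) b)) q = - ext_inner n (wedge a (wedge x b)) q"
        for a b by (simp add: ext_inner_eq sum_negf)
      then show "\<ominus>\<^bsub>ext_alg n\<^esub> x \<in> J"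
        using x R.a_inv_closed[OF xc] by (simp add: J_def eq)
    next
      fix x y assume xy: "x \<in> J" "y \<in> J"
      have "wedge a (wedge (x + y) b) = wedge a (wedge x b) + wedge a (wedge y b)" for a b
        unfolding plus_fun_def wedge_distrib ..
      then show "x \<oplus>\<^bsub>ext_alg n\<^esub> y \<in> J"
        using xy R.a_closed[of x y] by (auto simp: J_def add ext_inner_add simp del: pointwise_apply)
    qed
  next
    fix p x assume px: "p \<in> J" "x \<in> ?R"
    have "ext_inner n (wedge a (wedge (wedge x p) b)) q = 0" if "a \<in> ?R" "b \<in> ?R" for a b
    proof -
      have "wedge a (wedge (wedge x p) b) = wedge (wedge a x) (wedge p b)"
        by (simp add: wedge_assoc)
      then show ?thesis using px that wedge_carrier[of a n x] by (simp add: J_def)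
    qed
    then show "x \<otimes>\<^bsub>ext_alg n\<^esub> p \<in> J"
      using px wedge_carrier by (simp add: J_def mul)
    have "ext_inner n (wedge a (wedge (wedge p x) b)) q = 0" if "a \<in> ?R" "b \<in> ?R" for a b
      using px that wedge_carrier[of x n b] by (simp add: J_def wedge_assoc)
    then show "p \<otimes>\<^bsub>ext_alg n\<^esub> x \<in> J"
      using px wedge_carrier by (simp add: J_def mul)
  qed
  moreover have "F1 n r \<in> J" if r: "0 < r" for r
  proof -
    have "ext_inner n (wedge a (wedge (F1 n r) b)) q = 0" if ab: "a \<in> ?R" "b \<in> ?R" for a b
    proof -
      let ?a = "\<lambda>A. (- 1) ^ (card A * r) * a A"
      have "?a \<in> ?R" using ab by (auto simp: ext_alg_carrier)
      then have "wedge ?a b \<in> ?R" using ab wedge_carrier by blast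
      moreover have "wedge a (wedge (F1 n r) b) = wedge (F1 n r) (wedge ?a b)"
        unfolding wedge_assoc[symmetric] wedge_F1_commute[of a] ..
      ultimately have "ext_inner n (wedge a (wedge (F1 n r) b)) q = ext_inner n (wedge ?a b) 0"
        using ext_inner_F1[of n n "wedge ?a b" r q] F[OF r] by simp
      then show ?thesis by (simp add: ext_inner_eq)
    qed
    then show ?thesis using F1_carrier by (simp add: J_def)
  qed
  ultimately have "EQI n \<subseteq> J"
    unfolding EQI_def by (intro R.genideal_minimal) auto
  moreover have "ext_inner n p q = 0" if "p \<in> J" for p
  proof -
    have 1: "theta {} \<in> ?R" by (rule theta_carrier) simp
    have "p \<in> ?R" using that by (simp add: J_def)
    then have "wedge (theta {}) (wedge p (theta {})) = p" by (simp add: wedge_one)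
    then show ?thesis using that 1 by (force simp: J_def)
  qed
  ultimately show ?thesis using q by (auto simp: EQH_carrier)
qed

section \<open>The elements \<open>\<Delta>\<close>\<close>

text \<open>The product \<open>Delta\<close> expressed through \<open>tmul\<close>, to which the
  anticommutation rules apply directly.\<close>

fun diff_prod :: "(nat \<times> nat) list \<Rightarrow> ext" where
  "diff_prod [] = theta {}"
| "diff_prod ((i, j) # C) = tmul j (diff_prod C) - tmul i (diff_prod C)"

lemma ext_alg_minus:
  assumes "p \<in> carrier (ext_alg n)" "q \<in> carrier (ext_alg n)"
  shows "p \<ominus>\<^bsub>ext_alg n\<^esub> q = p - q"
proof -
  interpret R: ring "ext_alg n" by (rule ring_ext_alg)
  have "\<ominus>\<^bsub>ext_alg n\<^esub> q = (\<lambda>A. - q A)"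
    by (rule R.minus_equality) (use assms in \<open>auto simp: ext_alg_def\<close>)
  then show ?thesis by (simp add: a_minus_def) (simp add: ext_alg_def fun_eq_iff)
qed

lemma wedge_minus_left: "wedge (p - p') q = wedge p q - wedge p' q"
  by (simp add: fun_eq_iff wedge_def algebra_simps sum_subtractf)

lemma wedge_theta_carrier:
  assumes "p \<in> carrier (ext_alg n)"
  shows "wedge (theta {k}) p = tmul k p"
proof
  fix B
  show "wedge (theta {k}) p B = tmul k p B"
  proof (cases "finite B")
    case False
    then have "p (B - {k}) = 0" by (intro ext_alg_finite[OF assms]) auto
    then show ?thesis using False by (simp add: wedge_def tmul_def)
  qed (rule wedge_theta_left)
qed

lemma Delta_eq_diff_prod:
  assumes "\<And>i j. (i, j) \<in> set C \<Longrightarrow> i \<in> {1..n} \<and> j \<in> {1..n}"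
  shows "Delta n C = diff_prod C \<and> diff_prod C \<in> carrier (ext_alg n)"
  using assms
proof (induction C rule: diff_prod.induct)
  case 1
  show ?case by (simp add: Delta_def) (simp add: ext_alg_def theta_def)
next
  case (2 i j C)
  have IH: "Delta n C = diff_prod C" "diff_prod C \<in> carrier (ext_alg n)"
    using 2 by auto
  have th: "theta {i} \<in> carrier (ext_alg n)" "theta {j} \<in> carrier (ext_alg n)"
    using "2.prems"[of i j] by (auto intro!: theta_carrier)
  interpret R: ring "ext_alg n" by (rule ring_ext_alg)
  have 1: "Delta n ((i, j) # C) = (theta {j} \<ominus>\<^bsub>ext_alg n\<^esub> theta {i}) \<otimes>\<^bsub>ext_alg n\<^esub> Delta n C"
    by (simp add: Delta_def)
  also have "\<dots> = wedge (theta {j} - theta {i}) (diff_prod C)"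
    unfolding ext_alg_minus[OF th(2,1)] IH(1) by (simp add: ext_alg_def)
  also have "\<dots> = diff_prod ((i, j) # C)"
    unfolding wedge_minus_left wedge_theta_carrier[OF IH(2)] by simp
  finally have "Delta n ((i, j) # C) = diff_prod ((i, j) # C)" .
  moreover have "Delta n ((i, j) # C) \<in> carrier (ext_alg n)"
    unfolding 1 using th IH by simp
  ultimately show ?case by metis
qed

text \<open>The ordered product of the operators \<open>1 + t \<partial>\<^sub>l\<close>, the head of the list acting first; it is
  the generating function of the \<^const>\<open>Fadj\<close> (lemma \<open>Dexp_eq_sum_Fadj\<close>).\<close>

definition Dexp :: "rat \<Rightarrow> nat list \<Rightarrow> ext \<Rightarrow> ext" where
  "Dexp t L q = fold (\<lambda>l q. q + scale t (dtheta l q)) L q"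

section \<open>Invariance of the products under the operators 1 + t d_l\<close>

lemma Dexp_simps [simp]:
  "Dexp t [] q = q"
  "Dexp t (l # L) q = Dexp t L (q + scale t (dtheta l q))"
  "Dexp t (L @ L') q = Dexp t L' (Dexp t L q)"
  by (simp_all add: Dexp_def)

lemma Dexp_0 [simp]: "Dexp t L 0 = 0"
  by (induction L) (simp_all del: pointwise_apply)

lemma scale_minus_left [simp]: "scale (- c) p = - scale c p"
  by (simp add: scale_def fun_eq_iff)

text \<open>Since d_i (1 + t d_l) = (1 - t d_l) d_i, passing an odd operator through the product
  changes the sign of t. The same reason underlies \<open>Dexp_mult\<close>.\<close>

lemma dtheta_Dexp: "dtheta i (Dexp t L q) = Dexp (- t) L (dtheta i q)"
  by (induction L arbitrary: q) (simp_all add: dtheta_anticomm[of i] del: pointwise_apply)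

lemma Dexp_mult:
  assumes "i \<notin> set L" "j \<notin> set L"
  shows "Dexp t L (tmul j q - tmul i q) = tmul j (Dexp (- t) L q) - tmul i (Dexp (- t) L q)"
  using assms
proof (induction L arbitrary: q)
  case (Cons l L)
  have "tmul j q - tmul i q + scale t (dtheta l (tmul j q - tmul i q)) =
      tmul j (q + scale (- t) (dtheta l q)) - tmul i (q + scale (- t) (dtheta l q))"
    using Cons.prems by (simp add: dtheta_tmul del: pointwise_apply)
  moreover have "Dexp t L (tmul j q' - tmul i q') =
      tmul j (Dexp (- t) L q') - tmul i (Dexp (- t) L q')" for q'
    by (rule Cons.IH) (use Cons.prems in auto)
  ultimately show ?case by (simp only: Dexp_simps)
qed simp

text \<open>The factor at i adds - t q and the factor at j adds t q, which cancel; the term in t^2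
  vanishes because d_j q = 0.\<close>

lemma Dexp_pair:
  assumes "i \<noteq> j" "dtheta i q = 0" "dtheta j q = 0"
  shows "Dexp t [i, j] (tmul j q - tmul i q) = tmul j q - tmul i q"
  using assms by (simp add: dtheta_tmul dtheta_tmul_same)

lemma dtheta_theta_empty [simp]: "dtheta l (theta {}) = 0"
  by (auto simp: dtheta_alt theta_def fun_eq_iff)

lemma dtheta_diff_prod:
  assumes "\<And>i j. (i, j) \<in> set C \<Longrightarrow> k \<noteq> i \<and> k \<noteq> j"
  shows "dtheta k (diff_prod C) = 0"
  using assms
proof (induction C rule: diff_prod.induct)
  case (2 i j C)
  have "dtheta k (diff_prod C) = 0" by (rule "2.IH") (use "2.prems" in auto)
  moreover have "k \<noteq> i" "k \<noteq> j" using "2.prems"[of i j] by auto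
  ultimately show ?case by (simp add: dtheta_tmul del: pointwise_apply)
qed simp

text \<open>Every closing parenthesis finds a partner when reading starts with h unmatched open
  ones.\<close>

fun closable :: "nat \<Rightarrow> nat list \<Rightarrow> bool" where
  "closable h [] \<longleftrightarrow> True"
| "closable h (a # \<alpha>) \<longleftrightarrow> (if a = 0 then closable (Suc h) \<alpha> else 0 < h \<and> closable (h - 1) \<alpha>)"

lemma matching_positions:
  assumes "(i, k) \<in> set (matching j st \<alpha>)" "set st \<subseteq> {..<j}"
  shows "i < k \<and> k \<in> {j..<j + length \<alpha>} \<and> i \<in> set st \<union> {j..<j + length \<alpha>}"
  using assms
proof (induction j st \<alpha> rule: matching.induct)
  case (2 j st a \<alpha>)
  show ?case
  proof (cases "a = 0")
    case True
    have "set (j # st) \<subseteq> {..<Suc j}" using 2(5) by auto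
    then show ?thesis using 2(1)[OF True] 2(4) True by fastforce
  next
    case False
    show ?thesis
    proof (cases st)
      case Nil
      then show ?thesis using 2(2)[OF False Nil] 2(4) False by fastforce
    next
      case (Cons s st')
      have "set st' \<subseteq> {..<Suc j}" using 2(5) Cons by auto
      then show ?thesis using 2(3)[OF False Cons] 2(4,5) Cons False by fastforce
    qed
  qed
qed simp

lemma sorted_matching:
  "sorted_wrt (<) (map snd (matching j st \<alpha>)) \<and> (\<forall>x\<in>set (matching j st \<alpha>). j \<le> snd x)"
proof (induction j st \<alpha> rule: matching.induct)
  case (2 j st a \<alpha>)
  have weaken: "\<forall>x\<in>S. Suc j \<le> snd x \<Longrightarrow> \<forall>x\<in>S. j \<le> snd x" for S :: "(nat \<times> nat) set"
    using Suc_leD by blast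
  show ?case
  proof (cases "a = 0")
    case True
    then show ?thesis using 2(1)[OF True] weaken by auto
  next
    case False
    show ?thesis
    proof (cases st)
      case Nil
      then show ?thesis using 2(2)[OF False Nil] False weaken by auto
    next
      case (Cons i st')
      then show ?thesis using 2(3)[OF False Cons] False weaken by (auto simp: Suc_le_eq)
    qed
  qed
qed simp

lemma snd_matching:
  "closable (length st) \<alpha> \<Longrightarrow>
    snd ` set (matching j st \<alpha>) = {j + k | k. k < length \<alpha> \<and> \<alpha> ! k \<noteq> 0}"
proof (induction j st \<alpha> rule: matching.induct)
  case (2 j st a \<alpha>)
  have split: "{j + k | k. k < length (a # \<alpha>) \<and> (a # \<alpha>) ! k \<noteq> 0} =
      (if a = 0 then {} else {j}) \<union> {Suc j + k | k. k < length \<alpha> \<and> \<alpha> ! k \<noteq> 0}"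
  proof -
    have "k < length (a # \<alpha>) \<and> (a # \<alpha>) ! k \<noteq> 0 \<longleftrightarrow>
       (k = 0 \<and> a \<noteq> 0) \<or> (\<exists>k'. k = Suc k' \<and> k' < length \<alpha> \<and> \<alpha> ! k' \<noteq> 0)" for k
      by (cases k) auto
    then show ?thesis by (simp only:) auto
  qed
  show ?case
  proof (cases "a = 0")
    case True
    then show ?thesis using 2 unfolding split by simp
  next
    case False
    then obtain s st' where st: "st = s # st'" using 2(4) by (cases st) auto
    then have "closable (length st') \<alpha>" using 2(4) False by simp
    then show ?thesis using 2(3)[OF False st] False st unfolding split by simp
  qed
qed simp

text \<open>The list holds the positions not yet matched: the stack from the outside in, then the
  unread letters. When j closes the top i of the stack, i and j are neighbours in it and can be
  treated by \<open>Dexp_pair\<close>; deleting both leaves the list for the induction hypothesis.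
  The statement is for all t because the other factors change its sign on the way.\<close>

lemma Dexp_matching:
  assumes "closable (length st) \<alpha>" "distinct st" "set st \<subseteq> {..<j}"
  shows "Dexp t (rev st @ [j..<j + length \<alpha>]) (diff_prod (matching j st \<alpha>)) =
    diff_prod (matching j st \<alpha>)"
  using assms
proof (induction j st \<alpha> arbitrary: t rule: matching.induct)
  case (1 j st)
  have "Dexp t L (theta {}) = theta {}" for L by (induction L) simp_all
  then show ?case by simp
next
  case (2 j st a \<alpha>)
  have upt: "[j..<j + length (a # \<alpha>)] = j # [Suc j..<Suc j + length \<alpha>]"
    using upt_conv_Cons[of j "j + length (a # \<alpha>)"] by simp
  show ?case
  proof (cases "a = 0")
    case True
    have "Dexp t (rev (j # st) @ [Suc j..<Suc j + length \<alpha>]) (diff_prod (matching (Suc j) (j # st) \<alpha>)) =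
      diff_prod (matching (Suc j) (j # st) \<alpha>)"
      by (rule 2(1)[OF True]) (use 2(4-6) True in auto)
    then show ?thesis using True unfolding upt by simp
  next
    case False
    then obtain i st' where st: "st = i # st'" using 2(4) by (cases st) auto
    define g where "g = diff_prod (matching (Suc j) st' \<alpha>)"
    let ?L1 = "rev st'" and ?L2 = "[Suc j..<Suc j + length \<alpha>]"
    have i: "i < j" "i \<notin> set st'" "j \<notin> set st'" "set st' \<subseteq> {..<Suc j}"
      using 2(5,6) st by auto
    have IH: "Dexp t (?L1 @ ?L2) g = g" for t
      unfolding g_def by (rule 2(3)[OF False st]) (use 2(4-6) False st i in auto)
    have "i \<noteq> k \<and> i \<noteq> l \<and> j \<noteq> k \<and> j \<noteq> l" if "(k, l) \<in> set (matching (Suc j) st' \<alpha>)" for k l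
      using matching_positions[OF that i(4)] i by auto
    then have d: "dtheta i g = 0" "dtheta j g = 0"
      unfolding g_def by (auto intro!: dtheta_diff_prod)
    \<comment> \<open>The factors before i turn g into g'. Both d_i and d_j kill g and hence g', so
      \<open>Dexp_pair\<close> applies to g'.\<close>
    define g' where "g' = Dexp (- t) ?L1 g"
    have "Dexp t ?L1 (tmul j g - tmul i g) = tmul j g' - tmul i g'"
      unfolding g'_def by (rule Dexp_mult) (use i in auto)
    moreover have "Dexp t [i, j] (tmul j g' - tmul i g') = tmul j g' - tmul i g'"
      using i d by (intro Dexp_pair) (auto simp: g'_def dtheta_Dexp)
    moreover have "Dexp t ?L2 (tmul j g' - tmul i g') =
        tmul j (Dexp (- t) ?L2 g') - tmul i (Dexp (- t) ?L2 g')"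
      by (rule Dexp_mult) (use i in auto)
    moreover have "Dexp (- t) ?L2 g' = g" using IH[of "- t"] by (simp only: Dexp_simps g'_def)
    ultimately have "Dexp t (?L1 @ [i, j] @ ?L2) (tmul j g - tmul i g) = tmul j g - tmul i g"
      by (simp only: Dexp_simps(3))
    moreover have "rev st @ [j..<j + length (a # \<alpha>)] = ?L1 @ [i, j] @ ?L2"
      unfolding upt st by simp
    moreover have "diff_prod (matching j st (a # \<alpha>)) = tmul j g - tmul i g"
      using False st by (simp add: g_def)
    ultimately show ?thesis by (simp only:)
  qed
qed

section \<open>From invariance to the vanishing of the adjoints\<close>

lemma dtheta_sum: "dtheta i (sum f S) = (\<Sum>x\<in>S. dtheta i (f x))"
  by (induction S rule: infinite_finite_induct) (simp_all del: pointwise_apply)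

lemma scale_sum: "scale c (sum f S) = (\<Sum>x\<in>S. scale c (f x))"
  by (induction S rule: infinite_finite_induct) (simp_all del: pointwise_apply)

lemma scale_scale [simp]: "scale a (scale b p) = scale (a * b) p"
  by (simp add: scale_def fun_eq_iff)

lemma Dexp_eq_sum_Fadj: "Dexp t [1..<Suc n] q = (\<Sum>r\<le>n. scale (t ^ r) (Fadj n r q))"
proof (induction n)
  case (Suc n)
  let ?k = "Suc n"
  let ?S = "\<Sum>r\<le>n. scale (t ^ r) (Fadj n r q)"
  have "(\<Sum>r\<le>Suc n. scale (t ^ r) (Fadj (Suc n) r q)) =
      q + (\<Sum>r\<le>n. scale (t ^ Suc r) (Fadj n (Suc r) q) + scale t (dtheta ?k (scale (t ^ r) (Fadj n r q))))"
    by (simp only: sum.atMost_Suc_shift Fadj.simps scale_simps power_0 scale_dtheta scale_scale power_Suc)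
  also have "\<dots> = (q + (\<Sum>r\<le>n. scale (t ^ Suc r) (Fadj n (Suc r) q))) + scale t (dtheta ?k ?S)"
    by (simp only: sum.distrib dtheta_sum scale_sum add.assoc)
  also have "q + (\<Sum>r\<le>n. scale (t ^ Suc r) (Fadj n (Suc r) q)) = (\<Sum>r\<le>Suc n. scale (t ^ r) (Fadj n r q))"
    by (simp only: sum.atMost_Suc_shift Fadj.simps scale_simps power_0)
  \<comment> \<open>The term r = n + 1 is zero because only n variables are available.\<close>
  also have "\<dots> = ?S" by (simp add: Fadj_too_large)
  finally have "(\<Sum>r\<le>?k. scale (t ^ r) (Fadj ?k r q)) = ?S + scale t (dtheta ?k ?S)" .
  moreover have "[1..<Suc ?k] = [1..<?k] @ [?k]" by simp
  ultimately show ?case using Suc by (simp only: Dexp_simps)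
qed simp

text \<open>At each monomial the invariance is a polynomial identity in t valid for all rationals,
  so the coefficients of the positive powers of t vanish.\<close>

lemma Fadj_zero_if_Dexp_fixed:
  assumes "\<And>t. Dexp t [1..<Suc n] q = q" "0 < r"
  shows "Fadj n r q = 0"
proof (cases "r \<le> n")
  case True
  have "Fadj n r q B = 0" for B
  proof -
    let ?p = "(\<Sum>s\<le>n. monom (Fadj n s q B) s) - monom (q B) 0"
    have "poly ?p t = 0" for t
    proof -
      have apply_sum: "sum f S B = (\<Sum>s\<in>S. f s B)" for f :: "nat \<Rightarrow> ext" and S
        by (induction S rule: infinite_finite_induct) simp_all
      have "q B = (\<Sum>s\<le>n. scale (t ^ s) (Fadj n s q)) B"
        using assms(1)[of t] unfolding Dexp_eq_sum_Fadj by simp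
      also have "\<dots> = (\<Sum>s\<le>n. t ^ s * Fadj n s q B)" by (simp only: apply_sum scale_def)
      finally have "q B = (\<Sum>s\<le>n. t ^ s * Fadj n s q B)" .
      then show ?thesis by (simp add: poly_sum poly_monom mult.commute)
    qed
    then have "?p = 0" using poly_all_0_iff_0 by blast
    then have "coeff ?p r = 0" by simp
    then show ?thesis using True assms(2)
      by (simp add: coeff_sum sum.delta')
  qed
  then show ?thesis by (simp add: fun_eq_iff)
qed (simp add: Fadj_too_large)

text \<open>Taking the closing variable from every factor gives the heaviest monomial; any choice of
  i instead of j lowers the sum of the indices. Its coefficient is 1 since the closing positions are
  already sorted. Finiteness is carried along because sums over infinite sets are 0 by
  default.\<close>

lemma diff_prod_leading:
  assumes "sorted_wrt (<) (map snd C)" "\<And>i j. (i, j) \<in> set C \<Longrightarrow> i < j"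
  shows "diff_prod C (snd ` set C) = 1 \<and>
    (\<forall>B. diff_prod C B \<noteq> 0 \<longrightarrow> finite B \<and> (B = snd ` set C \<or> \<Sum>B < \<Sum>(snd ` set C)))"
  using assms
proof (induction C rule: diff_prod.induct)
  case 1
  then show ?case by (auto simp: theta_def)
next
  case (2 i j C)
  let ?A = "snd ` set C" and ?p = "diff_prod C"
  have IH: "?p ?A = 1" "\<And>B. ?p B \<noteq> 0 \<Longrightarrow> finite B" "\<And>B. ?p B \<noteq> 0 \<Longrightarrow> B \<noteq> ?A \<Longrightarrow> \<Sum>B < \<Sum>?A"
    using 2 by auto
  have ij: "i < j" and jA: "\<And>k. k \<in> ?A \<Longrightarrow> j < k"
    using "2.prems" by auto
  have sA: "snd ` set ((i, j) # C) = insert j ?A" by simp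
  have jn: "j \<notin> ?A" using jA by blast
  have sumA: "\<Sum>(insert j ?A) = j + \<Sum>?A" using jn by simp
  have le: "\<Sum>B \<le> \<Sum>?A" if "?p B \<noteq> 0" for B
    using IH(3)[OF that] by (cases "B = ?A") auto
  have sumB: "\<Sum>B = k + \<Sum>(B - {k})" if "finite B" "k \<in> B" for B :: "nat set" and k
    using that by (rule sum.remove)
  have "tmul j ?p (insert j ?A) = 1"
  proof -
    have "{l \<in> insert j ?A. l < j} = {}" using jA by force
    then have "sg j (insert j ?A) = 1" unfolding sg_def by (metis card.empty power_0)
    then show ?thesis using jn IH(1) by (simp add: tmul_def)
  qed
  moreover have "tmul i ?p (insert j ?A) = 0"
  proof (rule ccontr)
    assume "tmul i ?p (insert j ?A) \<noteq> 0"
    then have "i \<in> insert j ?A" "?p (insert j ?A - {i}) \<noteq> 0" by (auto simp: tmul_def split: if_splits)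
    then show False using jA[of i] ij by auto
  qed
  ultimately have 1: "diff_prod ((i, j) # C) (insert j ?A) = 1" by simp
  have 2: "finite B \<and> (B = insert j ?A \<or> \<Sum>B < \<Sum>(insert j ?A))"
    if "diff_prod ((i, j) # C) B \<noteq> 0" for B
  proof -
    from that consider (J) "tmul j ?p B \<noteq> 0" | (I) "tmul i ?p B \<noteq> 0" by fastforce
    then show ?thesis
    proof cases
      case J
      then have b: "j \<in> B" "?p (B - {j}) \<noteq> 0" by (auto simp: tmul_def split: if_splits)
      have fin: "finite B" using IH(2)[OF b(2)] by simp
      show ?thesis
      proof (cases "B - {j} = ?A")
        case True
        then show ?thesis using b(1) fin by blast
      next
        case False
        then show ?thesis using IH(3)[OF b(2)] sumB[OF fin b(1)] sumA fin by simp
      qed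
    next
      case I
      then have b: "i \<in> B" "?p (B - {i}) \<noteq> 0" by (auto simp: tmul_def split: if_splits)
      have fin: "finite B" using IH(2)[OF b(2)] by simp
      then show ?thesis using le[OF b(2)] sumB[OF fin b(1)] sumA ij by simp
    qed
  qed
  show ?case unfolding sA using 1 2 by blast
qed

section \<open>Bases\<close>

text \<open>The bound says that in each prefix the ones exceed the zeros by at most h, the initial
  height of the stack.\<close>

lemma closable_if_prefix_sums:
  assumes "set \<alpha> \<subseteq> {0, 1}" "\<And>r. r \<le> length \<alpha> \<Longrightarrow> 2 * sum_list (take r \<alpha>) \<le> r + h"
  shows "closable h \<alpha>"
  using assms
proof (induction \<alpha> arbitrary: h)
  case (Cons a \<alpha>)
  have le: "2 * (a + sum_list (take r \<alpha>)) \<le> Suc r + h" if "r \<le> length \<alpha>" for r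
    using Cons.prems(2)[of "Suc r"] that by simp
  show ?case
  proof (cases "a = 0")
    case True
    have "closable (Suc h) \<alpha>"
      by (rule Cons.IH) (use Cons.prems(1) le True in auto)
    then show ?thesis using True by simp
  next
    case False
    then have a: "a = 1" using Cons.prems(1) by auto
    then have "0 < h" using le[of 0] by simp
    moreover have "closable (h - 1) \<alpha>"
    proof (rule Cons.IH)
      fix r assume "r \<le> length \<alpha>"
      then show "2 * sum_list (take r \<alpha>) \<le> r + (h - 1)" using le[of r] a \<open>0 < h\<close> by simp
    qed (use Cons.prems(1) in auto)
    ultimately show ?thesis using a by simp
  qed
qed simp

lemma ballot_iff:
  "ballot \<alpha> \<longleftrightarrow> set \<alpha> \<subseteq> {0, 1} \<and> (\<forall>r\<le>length \<alpha>. 2 * sum_list (take r \<alpha>) \<le> r)"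
proof -
  have "rat_of_nat s \<le> rat_of_nat r / 2 \<longleftrightarrow> 2 * s \<le> r" for s r
  proof -
    have "rat_of_nat s \<le> rat_of_nat r / 2 \<longleftrightarrow> rat_of_nat (2 * s) \<le> rat_of_nat r"
      by (simp add: mult.commute)
    then show ?thesis by (simp only: of_nat_le_iff)
  qed
  moreover have "r = 0 \<or> r \<in> {1..length \<alpha>} \<longleftrightarrow> r \<le> length \<alpha>" for r by auto
  ultimately show ?thesis unfolding ballot_def by (metis le0 mult_0_right sum_list.Nil take0)
qed

definition closers :: "nat list \<Rightarrow> nat set" where
  "closers \<alpha> = {1 + k | k. k < length \<alpha> \<and> \<alpha> ! k \<noteq> 0}"

text \<open>Different sets can have the same weight, so A is required to be the only set of maximal
  weight in the support.\<close>

definition has_lead :: "ext \<Rightarrow> nat set \<Rightarrow> bool" where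
  "has_lead p A \<longleftrightarrow> p A = 1 \<and> (\<forall>B. p B \<noteq> 0 \<longrightarrow> B = A \<or> \<Sum>B < \<Sum>A)"

lemma has_lead_unique: "has_lead p A \<Longrightarrow> has_lead p B \<Longrightarrow> A = B"
  unfolding has_lead_def by (metis less_asym zero_neq_one)

lemma Delta_ballot:
  assumes "ballot \<alpha>" "length \<alpha> = n"
  shows "Delta n (match_pairs \<alpha>) \<in> carrier (EQH n)"
    and "has_lead (Delta n (match_pairs \<alpha>)) (closers \<alpha>)"
proof -
  let ?C = "match_pairs \<alpha>"
  have cl: "closable 0 \<alpha>" using assms by (intro closable_if_prefix_sums) (auto simp: ballot_iff)
  have pos: "i < j \<and> i \<in> {1..n} \<and> j \<in> {1..n}" if "(i, j) \<in> set ?C" for i j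
    using matching_positions[of i j 1 "[]" \<alpha>] that assms(2) by (auto simp: match_pairs_def)
  then have D: "Delta n ?C = diff_prod ?C" "diff_prod ?C \<in> carrier (ext_alg n)"
    using Delta_eq_diff_prod[of ?C n] by blast+
  have "Dexp t [1..<Suc n] (diff_prod ?C) = diff_prod ?C" for t
    using Dexp_matching[of "[]" \<alpha> 1 t] cl assms(2) by (simp add: match_pairs_def)
  then show "Delta n ?C \<in> carrier (EQH n)"
    unfolding D(1) using D(2) by (intro Fadj_imp_EQH Fadj_zero_if_Dexp_fixed)
  have "snd ` set ?C = closers \<alpha>"
    using snd_matching[of "[]" \<alpha> 1] cl by (simp add: match_pairs_def closers_def)
  moreover have "sorted_wrt (<) (map snd ?C)" using sorted_matching by (simp add: match_pairs_def)
  ultimately show "has_lead (Delta n ?C) (closers \<alpha>)"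
    unfolding D(1) has_lead_def using diff_prod_leading[of ?C] pos by metis
qed

lemma closers_inj:
  assumes "set \<alpha> \<subseteq> {0, 1}" "set \<beta> \<subseteq> {0, 1}" "length \<alpha> = length \<beta>" "closers \<alpha> = closers \<beta>"
  shows "\<alpha> = \<beta>"
proof (rule nth_equalityI)
  fix k assume k: "k < length \<alpha>"
  have "\<alpha> ! k \<noteq> 0 \<longleftrightarrow> 1 + k \<in> closers \<alpha>" "\<beta> ! k \<noteq> 0 \<longleftrightarrow> 1 + k \<in> closers \<beta>"
    using k assms(3) by (auto simp: closers_def)
  moreover have "\<alpha> ! k \<in> {0, 1}" "\<beta> ! k \<in> {0, 1}" using assms(1-3) k nth_mem by (metis subsetD)+
  ultimately have "\<alpha> ! k = 0 \<longleftrightarrow> \<beta> ! k = 0" "\<alpha> ! k = 0 \<or> \<alpha> ! k = 1" "\<beta> ! k = 0 \<or> \<beta> ! k = 1"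
    using assms(4) by blast+
  then show "\<alpha> ! k = \<beta> ! k" by metis
qed (rule assms)

lemma ballot_set_closers:
  assumes "ballot_set n A"
  shows "\<exists>\<alpha>. length \<alpha> = n \<and> ballot \<alpha> \<and> closers \<alpha> = A"
proof -
  let ?\<alpha> = "map (\<lambda>i. if Suc i \<in> A then 1 else 0 :: nat) [0..<n]"
  have A: "A \<subseteq> {1..n}" using assms by (simp add: ballot_set_def)
  have sums: "sum_list (take r ?\<alpha>) = card (A \<inter> {1..r})" if "r \<le> n" for r
    using that
  proof (induction r)
    case (Suc r)
    have "A \<inter> {1..Suc r} = (if Suc r \<in> A then insert (Suc r) (A \<inter> {1..r}) else A \<inter> {1..r})"
      by (auto simp: atLeastAtMostSuc_conv)
    then have "card (A \<inter> {1..Suc r}) = card (A \<inter> {1..r}) + (if Suc r \<in> A then 1 else 0)"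
      by simp
    moreover have "take (Suc r) ?\<alpha> = take r ?\<alpha> @ [if Suc r \<in> A then 1 else 0]"
      using Suc.prems by (subst take_Suc_conv_app_nth) auto
    ultimately show ?case using Suc by simp
  qed simp
  have "closers ?\<alpha> = A"
  proof (rule Set.set_eqI)
    fix x show "x \<in> closers ?\<alpha> \<longleftrightarrow> x \<in> A"
      using A by (cases x) (auto simp: closers_def split: if_splits)
  qed
  moreover have "ballot ?\<alpha>"
    using assms sums by (auto simp: ballot_iff ballot_set_def)
  ultimately show ?thesis by (intro exI[of _ ?\<alpha>]) simp
qed

section \<open>Spanning and independence through leading monomials\<close>

lemma finite_Dset: "finite (Dset n)"
proof -
  have "Dset n \<subseteq> (\<lambda>\<alpha>. Delta n (match_pairs \<alpha>)) ` {\<alpha>. set \<alpha> \<subseteq> {0, 1} \<and> length \<alpha> = n}"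
    by (auto simp: Dset_def ballot_def)
  then show ?thesis using finite_lists_length_eq[of "{0, 1 :: nat}" n] finite_surj by blast
qed

lemma Dset_EQH: "Dset n \<subseteq> carrier (EQH n)"
  using Delta_ballot(1) by (auto simp: Dset_def)

text \<open>\<open>Dset n\<close> is a set rather than a family, so the leading monomial is recorded
  as a function of the element; it recovers the ballot sequence.\<close>

lemma Dset_lead:
  obtains ld where "\<And>v. v \<in> Dset n \<Longrightarrow> has_lead v (ld v)" "inj_on ld (Dset n)"
    "\<And>A. ballot_set n A \<Longrightarrow> A \<in> ld ` Dset n"
proof -
  have "\<forall>v\<in>Dset n. \<exists>A. has_lead v A" using Delta_ballot(2) by (auto simp: Dset_def)
  then obtain ld where ld: "\<And>v. v \<in> Dset n \<Longrightarrow> has_lead v (ld v)" by metis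
  have ld_Delta: "ld (Delta n (match_pairs \<alpha>)) = closers \<alpha>" if "length \<alpha> = n" "ballot \<alpha>" for \<alpha>
    using ld[of "Delta n (match_pairs \<alpha>)"] Delta_ballot(2)[OF that(2,1)] that has_lead_unique
    by (auto simp: Dset_def)
  have "inj_on ld (Dset n)"
  proof (rule inj_onI)
    fix v w assume "v \<in> Dset n" "w \<in> Dset n" and eq: "ld v = ld w"
    then obtain \<alpha> \<beta> where v: "v = Delta n (match_pairs \<alpha>)" "length \<alpha> = n" "ballot \<alpha>"
      and w: "w = Delta n (match_pairs \<beta>)" "length \<beta> = n" "ballot \<beta>" by (auto simp: Dset_def)
    then have "\<alpha> = \<beta>" using eq ld_Delta by (intro closers_inj) (auto simp: ballot_def)
    then show "v = w" using v w by simp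
  qed
  moreover have "A \<in> ld ` Dset n" if A: "ballot_set n A" for A
  proof -
    obtain \<alpha> where \<alpha>: "length \<alpha> = n" "ballot \<alpha>" "closers \<alpha> = A"
      using ballot_set_closers[OF A] by blast
    then have "Delta n (match_pairs \<alpha>) \<in> Dset n" by (auto simp: Dset_def)
    then show ?thesis using ld_Delta[OF \<alpha>(1,2)] \<alpha>(3) by (metis image_eqI)
  qed
  ultimately show ?thesis using that ld by blast
qed

lemma Fadj_scale: "Fadj n r (scale c p) = scale c (Fadj n r p)"
  by (induction n r p rule: Fadj.induct) (simp_all del: pointwise_apply)

lemma EQH_iff_Fadj:
  "q \<in> carrier (EQH n) \<longleftrightarrow> q \<in> carrier (ext_alg n) \<and> (\<forall>r>0. Fadj n r q = 0)"
  using EQH_imp_Fadj Fadj_imp_EQH by (auto simp: EQH_carrier)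

lemma ext_alg_closed:
  "p \<in> carrier (ext_alg n) \<Longrightarrow> q \<in> carrier (ext_alg n) \<Longrightarrow> p - q \<in> carrier (ext_alg n)"
  "p \<in> carrier (ext_alg n) \<Longrightarrow> q \<in> carrier (ext_alg n) \<Longrightarrow> p + q \<in> carrier (ext_alg n)"
  "p \<in> carrier (ext_alg n) \<Longrightarrow> scale c p \<in> carrier (ext_alg n)"
proof -
  assume p: "p \<in> carrier (ext_alg n)"
  then show "scale c p \<in> carrier (ext_alg n)" by (simp add: ext_alg_carrier scale_def)
  assume q: "q \<in> carrier (ext_alg n)"
  have "A \<subseteq> {1..n}" if "p A \<noteq> 0 \<or> q A \<noteq> 0" for A using that p q by (auto simp: ext_alg_carrier)
  then show "p - q \<in> carrier (ext_alg n)" "p + q \<in> carrier (ext_alg n)"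
    unfolding ext_alg_carrier by force+
qed

lemma EQH_closed:
  "p \<in> carrier (EQH n) \<Longrightarrow> q \<in> carrier (EQH n) \<Longrightarrow> p - q \<in> carrier (EQH n)"
  "p \<in> carrier (EQH n) \<Longrightarrow> q \<in> carrier (EQH n) \<Longrightarrow> p + q \<in> carrier (EQH n)"
  "p \<in> carrier (EQH n) \<Longrightarrow> scale c p \<in> carrier (EQH n)"
  by (simp_all add: EQH_iff_Fadj ext_alg_closed Fadj_scale del: pointwise_apply)

lemma EQH_sum:
  assumes "\<And>v. v \<in> S \<Longrightarrow> f v \<in> carrier (EQH n)"
  shows "sum f S \<in> carrier (EQH n)"
proof -
  have "0 \<in> carrier (EQH n)" by (simp add: EQH_iff_Fadj ext_alg_carrier)
  then show ?thesis using assms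
    by (induction S rule: infinite_finite_induct) (auto intro: EQH_closed(2) simp del: pointwise_apply)
qed

lemma sum_apply: "sum f S B = (\<Sum>v\<in>S. f v (B :: nat set) :: rat)"
  by (induction S rule: infinite_finite_induct) simp_all

text \<open>Elimination from the heaviest ballot coefficients downwards: N bounds the weights at
  which they may still be nonzero. At N = 0 all of them vanish and
  \<open>zero_of_ballot_coefficients\<close> finishes.\<close>

lemma EQH_spanned:
  assumes "q \<in> carrier (EQH n)"
  shows "\<exists>c. q = (\<Sum>v\<in>Dset n. scale (c v) v)"
proof -
  obtain ld where ld: "\<And>v. v \<in> Dset n \<Longrightarrow> has_lead v (ld v)" "inj_on ld (Dset n)"
    "\<And>A. ballot_set n A \<Longrightarrow> A \<in> ld ` Dset n" by (rule Dset_lead) blast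
  have "\<exists>c. q = (\<Sum>v\<in>Dset n. scale (c v) v)"
    if "q \<in> carrier (EQH n)" "\<And>A. ballot_set n A \<Longrightarrow> N \<le> \<Sum>A \<Longrightarrow> q A = 0" for N q
    using that
  proof (induction N arbitrary: q)
    case 0
    have "q = 0"
    proof (rule zero_of_ballot_coefficients)
      show "A \<subseteq> {1..n}" if "q A \<noteq> 0" for A
        using 0(1) that by (simp add: EQH_iff_Fadj ext_alg_carrier)
    qed (use 0 in \<open>simp_all add: EQH_iff_Fadj\<close>)
    then show ?case by (intro exI[of _ "\<lambda>_. 0"]) simp
  next
    case (Suc N)
    \<comment> \<open>An element with leading weight N has no other monomial of weight N or more.
      Subtracting these multiples therefore clears the ballot coefficients of weight N and disturbs
      none above.\<close>
    define c where "c v = (if \<Sum>(ld v) = N then q (ld v) else 0)" for v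
    let ?s = "\<Sum>v\<in>Dset n. scale (c v) v"
    have "\<exists>d. q - ?s = (\<Sum>v\<in>Dset n. scale (d v) v)"
    proof (rule Suc.IH)
      show "q - ?s \<in> carrier (EQH n)"
        using Suc.prems(1) Dset_EQH by (intro EQH_closed EQH_sum) auto
      fix A assume A: "ballot_set n A" "N \<le> \<Sum>A"
      obtain v0 where v0: "v0 \<in> Dset n" "A = ld v0" using ld(3)[OF A(1)] by blast
      have other: "scale (c v) v A = 0" if "v \<in> Dset n" "v \<noteq> v0" for v
      proof (cases "\<Sum>(ld v) = N")
        case True
        have "A \<noteq> ld v" using that v0 ld(2) by (metis inj_onD)
        then have "v A = 0" using ld(1)[OF that(1)] A(2) True unfolding has_lead_def by (metis not_le)
        then show ?thesis by (simp add: scale_def)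
      qed (simp add: scale_def c_def)
      have "?s A = (\<Sum>v\<in>Dset n. scale (c v) v A)" by (rule sum_apply)
      also have "\<dots> = scale (c v0) v0 A"
        using finite_Dset v0 other by (subst sum.remove[of _ v0]) auto
      also have "\<dots> = c v0" using ld(1)[OF v0(1)] v0(2) by (simp add: scale_def has_lead_def)
      also have "\<dots> = q A"
        using Suc.prems(2)[OF A(1)] A(2) v0(2) by (auto simp: c_def)
      finally show "(q - ?s) A = 0" by simp
    qed
    then obtain d where "q - ?s = (\<Sum>v\<in>Dset n. scale (d v) v)" by blast
    then have "q = (\<Sum>v\<in>Dset n. scale (d v) v) + ?s" by (simp only: diff_eq_eq)
    also have "\<dots> = (\<Sum>v\<in>Dset n. scale (d v + c v) v)" by (simp only: sum.distrib scale_simps)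
    finally show ?case by (rule exI[of _ "\<lambda>v. d v + c v"])
  qed
  moreover have "q A = 0" if "ballot_set n A" "Suc (\<Sum>{1..n}) \<le> \<Sum>A" for A
  proof -
    have "\<Sum>A \<le> \<Sum>{1..n}" using that(1) by (intro sum_mono2) (auto simp: ballot_set_def)
    then show ?thesis using that(2) by simp
  qed
  ultimately show ?thesis using assms by blast
qed

text \<open>Among the elements with nonzero coefficient choose one of maximal leading weight; at its
  leading set no other element contributes.\<close>

lemma Dset_independent:
  assumes "(\<Sum>v\<in>Dset n. scale (c v) v) = 0" "w \<in> Dset n"
  shows "c w = 0"
proof (rule ccontr)
  assume "c w \<noteq> 0"
  obtain ld where ld: "\<And>v. v \<in> Dset n \<Longrightarrow> has_lead v (ld v)" "inj_on ld (Dset n)"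
    by (rule Dset_lead) blast
  let ?S = "{v \<in> Dset n. c v \<noteq> 0}"
  let ?W = "(\<lambda>v. \<Sum>(ld v)) ` ?S"
  have "finite ?S" "?S \<noteq> {}" using finite_Dset \<open>c w \<noteq> 0\<close> assms(2) by auto
  then have "Max ?W \<in> ?W" by (intro Max_in) auto
  then obtain v0 where v0: "Max ?W = \<Sum>(ld v0)" "v0 \<in> ?S" by (rule imageE)
  have other: "scale (c v) v (ld v0) = 0" if "v \<in> Dset n" "v \<noteq> v0" for v
  proof (cases "c v = 0")
    case False
    then have "\<Sum>(ld v) \<le> \<Sum>(ld v0)"
      unfolding v0(1)[symmetric] using that(1) \<open>finite ?S\<close> by (intro Max_ge) auto
    moreover have "ld v0 \<noteq> ld v" using that v0 ld(2) by (metis (no_types, lifting) inj_onD mem_Collect_eq)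
    ultimately have "v (ld v0) = 0" using ld(1)[OF that(1)] unfolding has_lead_def by (metis not_le)
    then show ?thesis by (simp add: scale_def)
  qed (simp add: scale_def)
  have "0 = (\<Sum>v\<in>Dset n. scale (c v) v) (ld v0)" using assms(1) by simp
  also have "\<dots> = (\<Sum>v\<in>Dset n. scale (c v) v (ld v0))" by (rule sum_apply)
  also have "\<dots> = scale (c v0) v0 (ld v0)"
    using finite_Dset v0 other by (subst sum.remove[of _ v0]) auto
  also have "\<dots> = c v0" using ld(1)[of v0] v0(2) by (simp add: scale_def has_lead_def)
  finally show False using v0(2) by simp
qed

section \<open>Orthogonal projection onto the ideal\<close>

lemma ext_inner_scale:
  "ext_inner n (scale c q) p = c * ext_inner n q p"
  "ext_inner n p (scale c q) = c * ext_inner n p q"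
  by (simp_all add: ext_inner_eq scale_def sum_distrib_left mult_ac)

lemma ext_inner_minus: "ext_inner n s (p - q) = ext_inner n s p - ext_inner n s q"
  by (simp add: ext_inner_eq right_diff_distrib sum_subtractf)

text \<open>Over the rationals projections cannot be obtained by minimisation; instead Gram-Schmidt is
  performed on the subspaces of elements supported in a growing set \<open>Y\<close> of monomials, each of which
  has codimension at most one in the next.\<close>

lemma orthogonal_projection:
  assumes J: "J \<subseteq> carrier (ext_alg n)" "\<And>p q. p \<in> J \<Longrightarrow> q \<in> J \<Longrightarrow> p + q \<in> J"
    "\<And>c p. p \<in> J \<Longrightarrow> scale c p \<in> J" "0 \<in> J"
  shows "\<exists>i\<in>J. \<forall>s\<in>J. ext_inner n s (p - i) = 0"
proof -
  have diff: "p - q \<in> J" if "p \<in> J" "q \<in> J" for p q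
    using J(2)[OF that(1) J(3)[OF that(2), of "- 1"]] by simp
  let ?J = "\<lambda>Y. {s \<in> J. \<forall>A. s A \<noteq> 0 \<longrightarrow> A \<in> Y}"
  have "\<exists>i\<in>?J Y. \<forall>s\<in>?J Y. ext_inner n s (p - i) = 0" if "finite Y" "Y \<subseteq> Pow {1..n}" for Y p
    using that
  proof (induction Y arbitrary: p)
    case empty
    have "s = 0" if "s \<in> ?J {}" for s using that by (simp add: fun_eq_iff)
    then show ?case using J(4) by (intro bexI[of _ 0]) (auto simp: ext_inner_eq)
  next
    case (insert y Y)
    have IH: "\<exists>i\<in>?J Y. \<forall>s\<in>?J Y. ext_inner n s (p - i) = 0" for p
      by (rule insert.IH) (use insert.prems in auto)
    show ?case
    proof (cases "?J (insert y Y) = ?J Y")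
      case True
      then show ?thesis using IH[of p] by (simp only:)
    next
      case False
      then obtain b where b: "b \<in> ?J (insert y Y)" "b \<notin> ?J Y" by blast
      then have bny: "b y \<noteq> 0" by auto
      obtain ib where ib: "ib \<in> ?J Y" "\<forall>s\<in>?J Y. ext_inner n s (b - ib) = 0"
        using IH[of b] by (elim bexE)
      obtain ip where ip: "ip \<in> ?J Y" "\<forall>s\<in>?J Y. ext_inner n s (p - ip) = 0"
        using IH[of p] by (elim bexE)
      \<comment> \<open>The new Gram-Schmidt vector. It is nonzero at y because \<open>ib\<close> is
        supported in Y, so its norm is positive.\<close>
      define b' where "b' = b - ib"
      have b'y: "b' y \<noteq> 0" using bny ib insert.hyps(2) by (auto simp: b'_def)
      have b'J: "b' \<in> J" unfolding b'_def using b(1) ib(1) diff by blast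
      have b'Y: "A \<in> insert y Y" if "b' A \<noteq> 0" for A
      proof -
        have "b A \<noteq> 0 \<or> ib A \<noteq> 0" using that by (auto simp: b'_def)
        then show ?thesis using b(1) ib(1) by blast
      qed
      let ?e = "ext_inner n b' b'"
      have "?e > 0"
        unfolding ext_inner_eq
        by (rule sum_pos2[of _ y]) (use insert.prems b'y in \<open>auto simp: zero_less_mult_iff neq_iff\<close>)
      define c where "c = ext_inner n b' (p - ip) / ?e"
      let ?i = "ip + scale c b'"
      have orth: "ext_inner n s (p - ?i) = ext_inner n s (p - ip) - c * ext_inner n s b'" for s
      proof -
        have "p - ?i = (p - ip) - scale c b'" by (simp only: diff_diff_eq)
        then show ?thesis by (simp only: ext_inner_minus ext_inner_scale)
      qed
      have "?i \<in> ?J (insert y Y)"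
      proof -
        have "?i \<in> J" using ip(1) b'J J(2,3) by blast
        moreover have "A \<in> insert y Y" if "?i A \<noteq> 0" for A
        proof -
          have "ip A \<noteq> 0 \<or> b' A \<noteq> 0" using that by (auto simp: scale_def)
          then show ?thesis using ip(1) b'Y by blast
        qed
        ultimately show ?thesis by blast
      qed
      moreover have "ext_inner n s (p - ?i) = 0" if s: "s \<in> ?J (insert y Y)" for s
      proof -
        \<comment> \<open>The multiple of b' that removes the monomial y from s, leaving an element
          supported in Y.\<close>
        define d where "d = s y / b' y"
        define s' where "s' = s - scale d b'"
        have "s' \<in> J" unfolding s'_def using s b'J J(3) diff by blast
        moreover have "A \<in> Y" if "s' A \<noteq> 0" for A
        proof -
          have "s A \<noteq> 0 \<or> b' A \<noteq> 0" using that by (auto simp: s'_def scale_def)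
          then have "A \<in> insert y Y" using s b'Y by blast
          moreover have "s' y = 0" using b'y by (simp add: s'_def d_def scale_def)
          ultimately show ?thesis using that by auto
        qed
        ultimately have s'J: "s' \<in> ?J Y" by blast
        have "ext_inner n s' b' = 0" unfolding b'_def by (rule bspec[OF ib(2) s'J])
        then have "ext_inner n s' (p - ?i) = 0" unfolding orth bspec[OF ip(2) s'J] by simp
        moreover have "ext_inner n b' (p - ?i) = 0"
          unfolding orth using \<open>?e > 0\<close> by (simp add: c_def)
        moreover have "ext_inner n s X = ext_inner n s' X + d * ext_inner n b' X" for X
          unfolding s'_def by (metis diff_add_cancel ext_inner_add(1) ext_inner_scale(1))
        ultimately show ?thesis by simp
      qed
      ultimately show ?thesis by blast
    qed
  qed
  from this[of "Pow {1..n}" p] obtain i where i: "i \<in> ?J (Pow {1..n})"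
    "\<And>s. s \<in> ?J (Pow {1..n}) \<Longrightarrow> ext_inner n s (p - i) = 0" by auto
  moreover have "s \<in> ?J (Pow {1..n})" if "s \<in> J" for s
  proof -
    have "s \<in> carrier (ext_alg n)" using that J(1) by blast
    then show ?thesis using that by (simp add: ext_alg_carrier)
  qed
  ultimately show ?thesis by blast
qed

lemma ext_inner_definite:
  assumes "p \<in> carrier (ext_alg n)" "ext_inner n p p = 0"
  shows "p = 0"
proof
  fix A
  have "\<forall>A\<in>Pow {1..n}. p A * p A = 0"
    using assms(2) unfolding ext_inner_eq by (subst (asm) sum_nonneg_eq_0_iff) auto
  then show "p A = 0 A" using assms(1) by (auto simp: ext_alg_carrier)
qed

section \<open>Bases of EQH_n and of the quotient\<close>

lemma ext_alg_simps:
  "x \<oplus>\<^bsub>ext_alg n\<^esub> y = x + y" "c \<odot>\<^bsub>ext_alg n\<^esub> x = scale c x" "\<zero>\<^bsub>ext_alg n\<^esub> = 0"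
  by (simp_all add: ext_alg_def scale_def fun_eq_iff)

lemma EQH_simps:
  "x \<oplus>\<^bsub>EQH n\<^esub> y = x + y" "c \<odot>\<^bsub>EQH n\<^esub> x = scale c x" "\<zero>\<^bsub>EQH n\<^esub> = 0"
  by (simp_all add: EQH_def ext_alg_simps)

lemma EQI_closed:
  "EQI n \<subseteq> carrier (ext_alg n)" "0 \<in> EQI n"
  "p \<in> EQI n \<Longrightarrow> q \<in> EQI n \<Longrightarrow> p + q \<in> EQI n" "p \<in> EQI n \<Longrightarrow> scale c p \<in> EQI n"
proof -
  interpret ideal "EQI n" "ext_alg n" by (rule ideal_EQI)
  show "EQI n \<subseteq> carrier (ext_alg n)" using a_subset .
  show "0 \<in> EQI n" using additive_subgroup.zero_closed[OF additive_subgroup_axioms]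
    by (simp add: ext_alg_simps)
  show "p \<in> EQI n \<Longrightarrow> q \<in> EQI n \<Longrightarrow> p + q \<in> EQI n"
    using additive_subgroup.a_closed[OF additive_subgroup_axioms, of p q] by (simp add: ext_alg_simps)
  show "p \<in> EQI n \<Longrightarrow> scale c p \<in> EQI n"
    using EQI_smult[of p n c] by (simp add: ext_alg_simps)
qed

lemma basis_EQH: "vectorspace.basis (class_ring :: rat ring) (EQH n) (Dset n)"
proof -
  interpret V: vectorspace "class_ring :: rat ring" "EQH n" by (rule vectorspace_EQH)
  have lincomb: "V.lincomb a S = (\<Sum>v\<in>S. scale (a v) v)" if "finite S" "S \<subseteq> carrier (EQH n)" for a S
    using that
  proof (induction S)
    case (insert x S)
    have "V.lincomb a (insert x S) = a x \<odot>\<^bsub>EQH n\<^esub> x \<oplus>\<^bsub>EQH n\<^esub> V.lincomb a S"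
      using insert by (intro V.lincomb_insert2) auto
    then show ?case using insert by (simp add: EQH_simps del: pointwise_apply)
  qed (simp add: V.lincomb_def EQH_simps)
  note D = finite_Dset Dset_EQH
  have "V.lin_indpt (Dset n)"
  proof (rule V.finite_lin_indpt2[OF D])
    fix a assume "V.lincomb a (Dset n) = \<zero>\<^bsub>EQH n\<^esub>"
    then have "(\<Sum>v\<in>Dset n. scale (a v) v) = 0" unfolding lincomb[OF D] EQH_simps .
    then have "\<forall>v\<in>Dset n. a v = 0" using Dset_independent by blast
    then show "\<forall>v\<in>Dset n. a v = \<zero>\<^bsub>class_ring\<^esub>" by simp
  qed
  moreover have "V.span (Dset n) = carrier (EQH n)"
  proof
    show "V.span (Dset n) \<subseteq> carrier (EQH n)" using Dset_EQH V.span_closed by blast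
    show "carrier (EQH n) \<subseteq> V.span (Dset n)"
    proof
      fix q assume "q \<in> carrier (EQH n)"
      then obtain c where "q = (\<Sum>v\<in>Dset n. scale (c v) v)" using EQH_spanned by blast
      then have "q = V.lincomb c (Dset n)" by (simp only: lincomb[OF D])
      then show "q \<in> V.span (Dset n)" unfolding V.finite_span[OF D] by auto
    qed
  qed
  ultimately show ?thesis using Dset_EQH by (simp add: V.basis_def)
qed

text \<open>The difference of two elements of EQH_n in the same coset lies in I_n and in EQH_n, so
  it is orthogonal to itself.\<close>

lemma EQproj_inj: "inj_on (EQproj n) (carrier (EQH n))"
proof (rule inj_onI)
  interpret ideal "EQI n" "ext_alg n" by (rule ideal_EQI)
  fix p q assume pq: "p \<in> carrier (EQH n)" "q \<in> carrier (EQH n)" "EQproj n p = EQproj n q"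
  have c: "p \<in> carrier (ext_alg n)" "q \<in> carrier (ext_alg n)" using pq by (simp_all add: EQH_carrier)
  have "p \<in> EQproj n q" using a_rcos_self[OF c(1)] pq(3) by (simp add: EQproj_def)
  then obtain h where "h \<in> EQI n" "p = h + q"
    by (auto simp: EQproj_def a_r_coset_def' ext_alg_simps)
  then have "p - q \<in> EQI n" by simp
  moreover have "p - q \<in> carrier (EQH n)" using pq by (intro EQH_closed)
  ultimately have "ext_inner n (p - q) (p - q) = 0" "p - q \<in> carrier (ext_alg n)"
    by (auto simp: EQH_carrier simp del: pointwise_apply)
  then have "p - q = 0" by (intro ext_inner_definite)
  then show "p = q" by simp
qed

text \<open>Subtracting from p its orthogonal projection onto I_n keeps the coset and lands in
  EQH_n.\<close>

lemma EQproj_surj: "EQproj n ` carrier (EQH n) = carrier (EQC n)"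
proof
  interpret ideal "EQI n" "ext_alg n" by (rule ideal_EQI)
  show "EQproj n ` carrier (EQH n) \<subseteq> carrier (EQC n)" by (auto simp: EQC_simps EQH_carrier)
  show "carrier (EQC n) \<subseteq> EQproj n ` carrier (EQH n)"
  proof
    fix X assume "X \<in> carrier (EQC n)"
    then obtain p where p: "p \<in> carrier (ext_alg n)" "X = EQproj n p" by (auto simp: EQC_simps)
    obtain i where i: "i \<in> EQI n" "\<And>s. s \<in> EQI n \<Longrightarrow> ext_inner n s (p - i) = 0"
      using orthogonal_projection[OF EQI_closed(1,3,4,2)] by blast
    have ic: "i \<in> carrier (ext_alg n)" using i(1) EQI_closed(1) by blast
    have h: "p - i \<in> carrier (ext_alg n)" using p ic by (intro ext_alg_closed)
    then have "p - i \<in> carrier (EQH n)" using i(2) by (simp add: EQH_carrier del: pointwise_apply)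
    moreover have "EQproj n (p - i) = EQproj n p"
    proof -
      have "p = i \<oplus>\<^bsub>ext_alg n\<^esub> (p - i)" by (simp add: ext_alg_simps)
      then have "p \<in> EQproj n (p - i)" using i(1) by (auto simp: EQproj_def a_r_coset_def')
      then show ?thesis unfolding EQproj_def using a_repr_independence[OF _ h] a_subgroup by metis
    qed
    ultimately show "X \<in> EQproj n ` carrier (EQH n)" using p(2) by (metis image_eqI)
  qed
qed

theorem corollary4p5:
  fixes n :: nat
  assumes "n \<ge> 1"
  shows "vectorspace.basis (class_ring :: rat ring) (EQH n) (Dset n) \<and>
    inj_on (EQproj n) (Dset n) \<and>
    vectorspace.basis (class_ring :: rat ring) (EQC n) (EQproj n ` Dset n)"
proof (intro conjI)
  show basis: "vectorspace.basis (class_ring :: rat ring) (EQH n) (Dset n)" by (rule basis_EQH)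
  show "inj_on (EQproj n) (Dset n)" using EQproj_inj Dset_EQH by (rule inj_on_subset)
  interpret V: vectorspace "class_ring :: rat ring" "EQH n" by (rule vectorspace_EQH)
  interpret W: vectorspace "class_ring :: rat ring" "EQC n" by (rule vectorspace_EQC)
  \<comment> \<open>Restricted to EQH_n, the projection is a linear isomorphism onto EQC_n and so
    carries the basis to a basis.\<close>
  have "EQproj n \<in> LinearCombinations.module_hom class_ring (EQH n) (EQC n)"
    unfolding LinearCombinations.module_hom_def
    using EQproj_surj EQproj_add EQproj_smult
    by (auto simp: EQH_simps EQH_carrier ext_alg_simps simp del: pointwise_apply)
  then interpret linear_map "class_ring :: rat ring" "EQH n" "EQC n" "EQproj n"
    by unfold_locales
  have "V.fin_dim"
    unfolding V.fin_dim_def using finite_Dset Dset_EQH basis by (auto simp: V.basis_def)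
  then show "vectorspace.basis (class_ring :: rat ring) (EQC n) (EQproj n ` Dset n)"
    by (rule linear_inj_image_is_basis[OF EQproj_inj EQproj_surj basis])
qed

end
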